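(* For every $c_1>0$ and $c_2>0$ there exists exactly one smooth, convex, closed, non-self-intersecting curve $\Gamma^*\subset\mathbb{R}^2$ with a unique maximal diameter, placed in the coordinate frame adapted to this diameter (the maximal diameter lies on the $x$-axis and its midpoint is the origin), that is time-invariant, i.e. satisfies $$-1+c_1A\kappa+c_2A\,y\cos\gamma=0\qquad\text{at every point }(x,y)\in\Gamma^*,$$ where $A$ is the area enclosed by $\Gamma^*$, and $\kappa$ and $\gamma$ are the curvature and turning angle of $\Gamma^*$ at that point.
   Context: Smooth means $C^\infty$. A closed, non-self-intersecting curve $\Gamma\subset\mathbb{R}^2$ has a unique maximal diameter if there is exactly one unordered pair of points $P,P'\in\Gamma$ with $|PP'|=\max_{X,Y\in\Gamma}|X-Y|$. The adapted frame is an orthonormal frame whose origin is the midpoint of $PP'$ and whose $x$-axis is the line $PP'$. Curves are identified with their images (point sets) in this frame. Parametrize $\Gamma$ by arc length $s$, traversed clockwise. The turning angle $\gamma$ is the angle between the $x$ direction and the tangent, so that $x_s=\cos\gamma$, $y_s=\sin\gamma$. The curvature is $\kappa=-\gamma_s$, so $\kappa\ge 0$ for convex curves. The stationary equation expresses that the normal speed vanishes in the geometric flow $\mathbf{x}_t=c_3(-1+c_1A\kappa+c_2Ay\cos\gamma)\mathbf{n}$, where $\mathbf{n}$ is the inward unit normal and $c_3>0$. *)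

theory Defs
  imports "HOL-Analysis.Analysis"
begin

definition smooth_fun :: "(real \<Rightarrow> real) \<Rightarrow> bool" where
  "smooth_fun f \<longleftrightarrow> (\<forall>n. (deriv ^^ n) f differentiable_on UNIV)"

(* A simple closed curve is identified with its image G in the plane; p is an L-periodic
   arc length parametrization of G and g a smooth choice of turning angle along p (it is
   unique up to a multiple of 2 pi, and not itself periodic).  With tangent (cos g, sin g)
   the normal to the right is (sin g, - cos g); clockwise means that it points into the
   enclosed region, so that it is the inward unit normal. *)
definition clockwise_arclength_param ::
    "(real \<times> real) set \<Rightarrow> real \<Rightarrow> (real \<Rightarrow> real \<times> real) \<Rightarrow> (real \<Rightarrow> real) \<Rightarrow> bool" where
  "clockwise_arclength_param G L p g \<longleftrightarrow>
     L > 0 \<and> (\<forall>s. p (s + L) = p s) \<and> inj_on p {0..<L} \<and> range p = G \<and>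
     smooth_fun (\<lambda>s. fst (p s)) \<and> smooth_fun (\<lambda>s. snd (p s)) \<and> smooth_fun g \<and>
     (\<forall>s. ((\<lambda>s. fst (p s)) has_real_derivative cos (g s)) (at s)) \<and>
     (\<forall>s. ((\<lambda>s. snd (p s)) has_real_derivative sin (g s)) (at s)) \<and>
     (\<forall>s. \<forall>\<^sub>F t in at_right 0. p s + t *\<^sub>R (sin (g s), - cos (g s)) \<in> inside G)"

definition smooth_simple_closed_curve :: "(real \<times> real) set \<Rightarrow> bool" where
  "smooth_simple_closed_curve G \<longleftrightarrow> (\<exists>L p g. clockwise_arclength_param G L p g)"

definition convex_curve :: "(real \<times> real) set \<Rightarrow> bool" where
  "convex_curve G \<longleftrightarrow> convex (inside G)"

definition enclosed_area :: "(real \<times> real) set \<Rightarrow> real" where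
  "enclosed_area G = measure lebesgue (inside G)"

definition max_diameter :: "(real \<times> real) set \<Rightarrow> real \<times> real \<Rightarrow> real \<times> real \<Rightarrow> bool" where
  "max_diameter G P P' \<longleftrightarrow> P \<in> G \<and> P' \<in> G \<and> (\<forall>X\<in>G. \<forall>Y\<in>G. dist X Y \<le> dist P P')"

definition unique_max_diameter :: "(real \<times> real) set \<Rightarrow> bool" where
  "unique_max_diameter G \<longleftrightarrow> (\<exists>!D. \<exists>P P'. D = {P, P'} \<and> max_diameter G P P')"

definition in_adapted_frame :: "(real \<times> real) set \<Rightarrow> bool" where
  "in_adapted_frame G \<longleftrightarrow>
     (\<forall>P P'. max_diameter G P P' \<longrightarrow> snd P = 0 \<and> snd P' = 0 \<and> midpoint P P' = 0)"

(* The curvature for clockwise traversal is kappa = - g'.  The condition does not depend on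
   the choice of (L, p, g): any two choices differ by a shift of the arc length parameter and
   by a constant multiple of 2 pi in the turning angle. *)
definition time_invariant :: "real \<Rightarrow> real \<Rightarrow> (real \<times> real) set \<Rightarrow> bool" where
  "time_invariant c1 c2 G \<longleftrightarrow>
     (\<exists>L p g. clockwise_arclength_param G L p g \<and>
        (\<forall>s. - 1 + c1 * enclosed_area G * (- deriv g s)
               + c2 * enclosed_area G * snd (p s) * cos (g s) = 0))"

end

theory Submission
  imports Defs
begin

text \<open>Put \<open>k = c\<^sub>2 / c\<^sub>1\<close> and \<open>a = c\<^sub>1 A\<close>. Along an invariant curve
  \<open>cos \<gamma> exp (k y\<^sup>2 / 2) - F y / a\<close> is constant, where \<open>F' y = exp (k y\<^sup>2 / 2)\<close> and \<open>F 0 = 0\<close>.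
  At an end of the maximal diameter \<open>y = cos \<gamma> = 0\<close>, so the constant is zero and
  \<open>a cos \<gamma> = D y\<close> with Dawson's function \<open>D y = exp (- k y\<^sup>2 / 2) F y\<close>. If \<open>M\<close> is the maximum
  of \<open>D\<close>, attained at \<open>ymax\<close>, then closedness forces \<open>a < M\<close> and \<open>\<bar>y\<bar> < ymax\<close>; on this range \<open>D\<close>
  has an inverse \<open>Y\<close>, so \<open>y = Y (a cos \<gamma>)\<close>, and integrating \<open>x\<close> shows that the curve is
  determined by \<open>a\<close>. Its area is \<open>a J a\<close> with \<open>J\<close> continuous and strictly increasing from \<open>0\<close> at
  \<open>a = 0\<close> to \<open>\<infinity>\<close> at \<open>a = M\<close>, so the condition \<open>c\<^sub>1 A = a\<close>, that is \<open>c\<^sub>1 J a = 1\<close>, has exactly one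
  solution. Conversely, convexity of \<open>Y\<close> on \<open>[0, M)\<close> makes the distance from the origin strictly
  increase towards the \<open>x\<close>-axis, so by central symmetry the horizontal chord through the
  origin is the unique maximal diameter.\<close>

section \<open>Primitives\<close>

text \<open>The oriented integral from 0, obtained as a normalized antiderivative so that negative
  arguments need no separate treatment.\<close>

definition primitive :: "(real \<Rightarrow> real) \<Rightarrow> real \<Rightarrow> real" where
  "primitive f = (SOME F. F 0 = 0 \<and> (\<forall>x. (F has_real_derivative f x) (at x)))"

lemma
  assumes "continuous_on UNIV f"
  shows primitive_0: "primitive f 0 = 0"
    and primitive_deriv: "(primitive f has_real_derivative f x) (at x)"
proof -
  obtain F where F: "\<And>x. (F has_vector_derivative f x) (at x)"
    using einterval_antiderivative[of "-\<infinity>" "\<infinity>" f] assms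
    by (auto simp: continuous_on_eq_continuous_at)
  have "\<exists>F. F 0 = 0 \<and> (\<forall>x. (F has_real_derivative f x) (at x))"
    by (rule exI[of _ "\<lambda>x. F x - F 0"])
      (use F in \<open>auto simp: has_real_derivative_iff_has_vector_derivative
         intro!: derivative_eq_intros\<close>)
  from someI_ex[OF this]
  show "primitive f 0 = 0" "(primitive f has_real_derivative f x) (at x)"
    unfolding primitive_def by auto
qed

lemma primitive_unique:
  assumes "continuous_on UNIV f" "\<And>x. (F has_real_derivative f x) (at x)"
  shows "F x = F 0 + primitive f x"
proof -
  have "\<forall>x. ((\<lambda>x. F x - primitive f x) has_real_derivative 0) (at x)"
    using assms primitive_deriv[OF assms(1)] by (auto intro!: derivative_eq_intros)
  from DERIV_isconst_all[OF this, of x 0] show ?thesis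
    using primitive_0[OF assms(1)] by simp
qed

lemma primitive_odd:
  assumes "continuous_on UNIV f" "\<And>x. f (- x) = f x"
  shows "primitive f (- x) = - primitive f x"
proof -
  have "((\<lambda>x. - primitive f (- x)) has_real_derivative f x) (at x)" for x
  proof -
    have "((\<lambda>x. primitive f (- x)) has_real_derivative f (- x) * (- 1)) (at x)"
      by (rule DERIV_chain2[OF primitive_deriv[OF assms(1)]]) (auto intro!: derivative_eq_intros)
    then show ?thesis using DERIV_minus assms(2)[of x] by fastforce
  qed
  from primitive_unique[OF assms(1) this, of x] show ?thesis
    using primitive_0[OF assms(1)] by simp
qed

section \<open>Dawson's function\<close>

locale dawson =
  fixes k :: real
  assumes k_pos: "k > 0"
begin

definition F :: "real \<Rightarrow> real" where
  "F = primitive (\<lambda>t. exp (k * t\<^sup>2 / 2))"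

definition D :: "real \<Rightarrow> real" where
  "D y = exp (- (k * y\<^sup>2 / 2)) * F y"

lemma F_0: "F 0 = 0"
  unfolding F_def by (rule primitive_0) (intro continuous_intros; simp)

lemma F_deriv [derivative_intros]: "(F has_real_derivative exp (k * y\<^sup>2 / 2)) (at y)"
  unfolding F_def by (rule primitive_deriv) (intro continuous_intros; simp)

lemma F_odd: "F (- y) = - F y"
  unfolding F_def by (rule primitive_odd) (auto intro!: continuous_intros)

lemma D_0 [simp]: "D 0 = 0"
  by (simp add: D_def F_0)

lemma D_odd [simp]: "D (- y) = - D y"
  by (simp add: D_def F_odd)

lemma F_eq: "F y = exp (k * y\<^sup>2 / 2) * D y"
  by (simp add: D_def mult.assoc[symmetric] exp_minus field_simps)

lemma D_deriv: "(D has_real_derivative 1 - k * y * D y) (at y)"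
proof -
  have "((\<lambda>y. exp (- (k * y\<^sup>2 / 2)) * F y) has_real_derivative
         exp (- (k * y\<^sup>2 / 2)) * (- (k * y)) * F y
          + exp (- (k * y\<^sup>2 / 2)) * exp (k * y\<^sup>2 / 2)) (at y)"
    by (auto intro!: derivative_eq_intros)
  moreover have "exp (- (k * y\<^sup>2 / 2)) * exp (k * y\<^sup>2 / 2) = (1::real)"
    by (simp add: exp_minus)
  ultimately show ?thesis
    by (simp add: D_def[abs_def] algebra_simps)
qed

lemmas D_deriv' [derivative_intros] = DERIV_chain2[OF D_deriv]

lemma D_isCont: "isCont D y"
  using D_deriv DERIV_isCont by blast

section \<open>Signs of \<open>D\<close> and of its derivative, and the maximum of
  \<open>D\<close>\<close>

lemma F_ge: "F y \<ge> y" if "y \<ge> 0"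
proof -
  have "F 0 - 0 \<le> F y - y"
  proof (rule DERIV_nonneg_imp_nondecreasing[OF that])
    fix x
    have "((\<lambda>x. F x - x) has_real_derivative exp (k * x\<^sup>2 / 2) - 1) (at x)"
      by (auto intro!: derivative_eq_intros)
    moreover have "exp (k * x\<^sup>2 / 2) - 1 \<ge> 0"
      using k_pos by simp
    ultimately show "\<exists>y. ((\<lambda>x. F x - x) has_real_derivative y) (at x) \<and> 0 \<le> y"
      by blast
  qed
  then show ?thesis by (simp add: F_0)
qed

lemma D_pos: "D y > 0" if "y > 0"
  using F_ge[of y] that by (simp add: D_def)

text \<open>The derivative of \<open>D\<close> times the positive factor
  \<open>exp (k * y\<^sup>2 / 2)\<close>. It has the same sign as that derivative, and in its own
  derivative everything but \<open>- k * F y\<close> cancels.\<close>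

definition N :: "real \<Rightarrow> real" where
  "N y = exp (k * y\<^sup>2 / 2) - k * y * F y"

lemma N_eq: "N y = exp (k * y\<^sup>2 / 2) * (1 - k * y * D y)"
  by (simp add: N_def F_eq algebra_simps)

lemma N_deriv: "(N has_real_derivative - k * F y) (at y)"
  unfolding N_def[abs_def] by (auto intro!: derivative_eq_intros)

lemma N_less: "N y < N x" if "0 \<le> x" "x < y"
proof (rule DERIV_neg_imp_decreasing_open[OF that(2)])
  fix z assume "x < z" "z < y"
  then have "F z > 0" using F_ge[of z] that by linarith
  then show "\<exists>d. (N has_real_derivative d) (at z) \<and> d < 0"
    using N_deriv[of z] k_pos by (intro exI[of _ "- k * F z"]) auto
next
  show "continuous_on {x..y} N"
    using N_deriv DERIV_isCont by (blast intro: continuous_at_imp_continuous_on)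
qed

text \<open>For positive \<open>y\<close> the equation says \<open>N y = 0\<close>. \<open>N\<close>
  starts at 1, strictly decreases, and falls at least as fast as
  \<open>1 - k * y\<^sup>2 / 2\<close> because \<open>F y \<ge> y\<close>.\<close>

lemma critical_point: "\<exists>!y. y > 0 \<and> k * y * D y = 1"
proof -
  \<comment> \<open>The zero of the upper bound \<open>1 - k * y\<^sup>2 / 2\<close> for
    \<open>N\<close>.\<close>
  define b where "b = sqrt (2 / k)"
  have b: "b > 0" "k * b\<^sup>2 = 2" using k_pos by (auto simp: b_def)
  have "N b + k * b\<^sup>2 / 2 \<le> N 0 + k * 0\<^sup>2 / 2"
  proof (rule DERIV_nonpos_imp_nonincreasing[of 0 b "\<lambda>x. N x + k * x\<^sup>2 / 2"])
    fix x assume x: "0 \<le> x" "x \<le> b"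
    have "((\<lambda>x. N x + k * x\<^sup>2 / 2) has_real_derivative - k * F x + k * x) (at x)"
      using N_deriv[of x] by (auto intro!: derivative_eq_intros)
    moreover have "- k * F x + k * x \<le> 0"
      using F_ge[of x] x k_pos by simp
    ultimately show "\<exists>y. ((\<lambda>x. N x + k * x\<^sup>2 / 2) has_real_derivative y) (at x) \<and> y \<le> 0"
      by blast
  qed (use b in auto)
  then have "N b \<le> 0" using b by (simp add: N_def)
  moreover have "N 0 = 1" by (simp add: N_def)
  moreover have "isCont N x" for x using N_deriv DERIV_isCont by blast
  ultimately obtain y where y: "0 \<le> y" "y \<le> b" "N y = 0"
    using IVT2[of N b 0 0] b by auto
  with \<open>N 0 = 1\<close> have "y > 0" "k * y * D y = 1"
    using N_eq[of y] by (cases "y = 0"; auto)+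
  moreover have "z = y" if "z > 0" "k * z * D z = 1" for z
  proof -
    have "N z = 0" using that by (simp add: N_eq)
    then show ?thesis using N_less[of z y] N_less[of y z] that y \<open>y > 0\<close> by linarith
  qed
  ultimately show ?thesis by blast
qed

definition ymax :: real where "ymax = (THE y. y > 0 \<and> k * y * D y = 1)"

definition M :: real where "M = D ymax"

lemma ymax_pos: "ymax > 0" and ymax_eq: "k * ymax * M = 1"
  using theI'[OF critical_point] unfolding ymax_def M_def by auto

lemma M_pos: "M > 0"
  unfolding M_def by (rule D_pos[OF ymax_pos])

lemma N_ymax: "N ymax = 0"
  using ymax_eq by (simp add: N_eq M_def)

lemma D_slope_pos: "k * y * D y < 1" if "\<bar>y\<bar> < ymax"
proof -
  have "N \<bar>y\<bar> > 0" using N_less[of "\<bar>y\<bar>" ymax] N_ymax that by auto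
  moreover have "k * \<bar>y\<bar> * D \<bar>y\<bar> = k * y * D y" by (cases "y \<ge> 0") auto
  ultimately show ?thesis unfolding N_eq by (simp add: zero_less_mult_iff)
qed

lemma D_slope_neg: "k * y * D y > 1" if "y > ymax"
proof -
  have "N y < 0" using N_less[of ymax y] N_ymax that ymax_pos by auto
  then show ?thesis unfolding N_eq by (simp add: mult_less_0_iff)
qed

lemma D_slope_nonneg: "k * y * D y \<ge> 0"
proof -
  have "y * D y \<ge> 0"
    using D_pos[of y] D_pos[of "- y"]
    by (cases y "0::real" rule: linorder_cases) (simp_all add: zero_le_mult_iff)
  then show ?thesis using k_pos by (simp add: mult.assoc)
qed

lemma D_less: "D x < D y" if "- ymax \<le> x" "x < y" "y \<le> ymax"
proof (rule DERIV_pos_imp_increasing_open[OF that(2)])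
  fix z assume "x < z" "z < y"
  then have "k * z * D z < 1" using that by (intro D_slope_pos) auto
  then show "\<exists>d. (D has_real_derivative d) (at z) \<and> 0 < d"
    using D_deriv[of z] by (intro exI[of _ "1 - k * z * D z"]) auto
qed (simp add: continuous_at_imp_continuous_on D_isCont)

lemma D_less_M: "D y < M" if "y \<ge> 0" "y \<noteq> ymax"
proof (cases "y < ymax")
  case True
  then show ?thesis unfolding M_def using that ymax_pos by (intro D_less) auto
next
  case False
  then have "ymax < y" using that by simp
  then show ?thesis unfolding M_def
  proof (rule DERIV_neg_imp_decreasing_open)
    fix z assume "ymax < z" "z < y"
    then have "k * z * D z > 1" by (intro D_slope_neg) auto
    then show "\<exists>d. (D has_real_derivative d) (at z) \<and> d < 0"
      using D_deriv[of z] by (intro exI[of _ "1 - k * z * D z"]) auto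
  qed (simp add: continuous_at_imp_continuous_on D_isCont)
qed

lemma D_le_M: "D y \<le> M" if "y \<ge> 0"
  using D_less_M[OF that] unfolding M_def by (cases "y = ymax") auto

text \<open>Chosen so that \<open>K\<^sup>2 = 2 * C / M\<close> for the constant \<open>C\<close> in
  the proof of \<open>D_near_max\<close>.\<close>

definition K :: real where "K = sqrt (k * (ymax + M) / M)"

lemma K_pos: "K > 0"
  unfolding K_def using k_pos ymax_pos M_pos by simp

text \<open>\<open>D\<close> is flat to first order at its maximum, so \<open>sin\<close> of the turning angle is at most
  linear in the distance to the height \<open>ymax\<close>.\<close>

lemma D_near_max:
  assumes "0 \<le> y" "y \<le> ymax"
  shows "1 - (D y / M)\<^sup>2 \<le> K\<^sup>2 * (ymax - y)\<^sup>2"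
proof -
  \<comment> \<open>As \<open>k * ymax * M = 1\<close>, the slope of \<open>D\<close> at
    \<open>x\<close> is \<open>k * (M * (ymax - x) + x * (M - D x))\<close>, which
    \<open>lip\<close> bounds by \<open>2 * C * (ymax - x)\<close>. Integrating gives the quadratic
    bound.\<close>
  define C where "C = k * (ymax + M) / 2"
  have lip: "M - D x \<le> ymax - x" if "0 \<le> x" "x \<le> ymax" for x
  proof -
    have "x - D x \<le> ymax - D ymax"
    proof (rule DERIV_nonneg_imp_nondecreasing[OF that(2)])
      fix z
      have "((\<lambda>x. x - D x) has_real_derivative k * z * D z) (at z)"
        by (auto intro!: derivative_eq_intros)
      then show "\<exists>d. ((\<lambda>x. x - D x) has_real_derivative d) (at z) \<and> 0 \<le> d"
        using D_slope_nonneg by blast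
    qed
    then show ?thesis by (simp add: M_def)
  qed
  have "D ymax + C * (ymax - ymax)\<^sup>2 \<le> D y + C * (ymax - y)\<^sup>2"
  proof (rule DERIV_nonpos_imp_nonincreasing[OF assms(2)])
    fix x assume x: "y \<le> x" "x \<le> ymax"
    let ?d = "1 - k * x * D x - 2 * C * (ymax - x)"
    have "((\<lambda>x. D x + C * (ymax - x)\<^sup>2) has_real_derivative ?d) (at x)"
      by (auto intro!: derivative_eq_intros simp: algebra_simps)
    moreover have "?d = k * (x * (M - D x)) - k * ymax * (ymax - x)"
      using ymax_eq unfolding C_def by (simp add: field_simps)
    moreover have "x * (M - D x) \<le> ymax * (ymax - x)"
      using x assms lip[of x] D_le_M[of x] by (intro mult_mono) auto
    then have "k * (x * (M - D x)) \<le> k * (ymax * (ymax - x))"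
      using k_pos by (intro mult_left_mono) auto
    ultimately show "\<exists>d. ((\<lambda>x. D x + C * (ymax - x)\<^sup>2) has_real_derivative d) (at x) \<and> d \<le> 0"
      by (intro exI[of _ ?d]) (simp add: mult.assoc)
  qed
  then have le: "M - D y \<le> C * (ymax - y)\<^sup>2" by (simp add: M_def)
  have D: "0 \<le> D y" "D y \<le> M"
    using D_pos[of y] D_le_M[of y] assms by (cases "y = 0"; simp)+
  have "1 - (D y / M)\<^sup>2 = (1 - D y / M) * (1 + D y / M)"
    by (simp add: algebra_simps power2_eq_square)
  also have "\<dots> \<le> (1 - D y / M) * 2"
    using D M_pos by (intro mult_left_mono) auto
  also have "\<dots> = 2 / M * (M - D y)"
    using M_pos by (simp add: field_simps)
  also have "\<dots> \<le> 2 / M * (C * (ymax - y)\<^sup>2)"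
    using le M_pos by (intro mult_left_mono) auto
  also have "\<dots> = K\<^sup>2 * (ymax - y)\<^sup>2"
    unfolding K_def C_def using k_pos ymax_pos M_pos by simp
  finally show ?thesis .
qed

section \<open>The inverse of \<open>D\<close> between its extrema\<close>

definition Y :: "real \<Rightarrow> real" where "Y = inv_into {-ymax..ymax} D"

lemma D_inj: "inj_on D {-ymax..ymax}"
  by (rule linorder_inj_onI) (auto dest!: D_less)

lemma Y_D: "Y (D y) = y" if "\<bar>y\<bar> \<le> ymax"
  unfolding Y_def using that by (intro inv_into_f_f D_inj) auto

lemma
  assumes "\<bar>v\<bar> < M"
  shows D_Y: "D (Y v) = v" and Y_bound: "\<bar>Y v\<bar> < ymax"
proof -
  have "\<exists>y. - ymax \<le> y \<and> y \<le> ymax \<and> D y = v"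
    by (rule IVT) (use assms ymax_pos D_isCont in \<open>auto simp: M_def\<close>)
  then obtain y where y: "\<bar>y\<bar> \<le> ymax" "D y = v" by (metis abs_le_iff minus_le_iff)
  have "y \<noteq> ymax" "y \<noteq> - ymax" using y assms by (auto simp: M_def)
  then show "D (Y v) = v" "\<bar>Y v\<bar> < ymax"
    using Y_D[OF y(1)] y by auto
qed

lemma Y_0 [simp]: "Y 0 = 0"
  using Y_D[of 0] ymax_pos by simp

lemma Y_odd: "Y (- v) = - Y v" if "\<bar>v\<bar> < M"
  using Y_D[of "- Y v"] D_Y[OF that] Y_bound[OF that] by simp

lemma Y_less: "Y u < Y v" if "\<bar>u\<bar> < M" "\<bar>v\<bar> < M" "u < v"
proof (rule ccontr)
  assume "\<not> Y u < Y v"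
  then have "D (Y v) \<le> D (Y u)"
    using D_less[of "Y v" "Y u"] Y_bound[OF that(1)] Y_bound[OF that(2)]
    by (smt (verit))
  then show False using that D_Y by simp
qed

lemma Y_pos: "Y v > 0" if "0 < v" "v < M"
  using Y_less[of 0 v] that by simp

text \<open>\<open>den v\<close> is \<open>D' (Y v)\<close>, so \<open>1 / den\<close> is the derivative of \<open>Y\<close>.\<close>

definition den :: "real \<Rightarrow> real" where "den v = 1 - k * v * Y v"

lemma den_pos: "den v > 0" if "\<bar>v\<bar> < M"
  using D_slope_pos[OF Y_bound[OF that]] D_Y[OF that] by (simp add: den_def algebra_simps)

lemma den_nz: "den v \<noteq> 0" if "\<bar>v\<bar> < M"
  using den_pos[OF that] by simp

lemma den_le_1: "den v \<le> 1" if "\<bar>v\<bar> < M"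
  using D_slope_nonneg[of "Y v"] D_Y[OF that] by (simp add: den_def algebra_simps)

lemma den_even: "den (- v) = den v" if "\<bar>v\<bar> < M"
  by (simp add: den_def Y_odd[OF that])

lemma den_less: "den v < den u" if "0 \<le> u" "u < v" "v < M"
proof -
  have "u * Y u < v * Y v"
    using Y_less[of u v] that Y_pos[of u] by (cases "u = 0") (auto intro!: mult_strict_mono Y_pos)
  then show ?thesis using k_pos by (simp add: den_def mult.assoc)
qed

lemma Y_deriv:
  assumes "\<bar>v\<bar> < M"
  shows "(Y has_real_derivative 1 / den v) (at v)"
proof -
  have D: "(D has_real_derivative den v) (at (Y v))"
    using D_deriv[of "Y v"] D_Y[OF assms] by (simp add: den_def algebra_simps)
  have "isCont Y (D (Y v))"
    by (rule isCont_inverse_function2[of "-ymax" _ ymax])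
      (use Y_bound[OF assms] Y_D D_isCont in auto)
  then have "isCont Y v" by (simp add: D_Y[OF assms])
  have "(Y has_real_derivative inverse (den v)) (at v)"
    by (rule DERIV_inverse_function[OF D _ _ _ _ \<open>isCont Y v\<close>, of "-M" M])
      (use den_pos[OF assms] assms D_Y in auto)
  then show ?thesis by (simp add: inverse_eq_divide)
qed

lemmas Y_deriv' [derivative_intros] = DERIV_chain2[OF Y_deriv]

lemma Y_cont: "continuous_on {-M<..<M} Y"
  by (rule continuous_at_imp_continuous_on) (auto intro!: DERIV_isCont[OF Y_deriv])

lemma Y_continuous_on [continuous_intros]:
  assumes "continuous_on S f" "\<And>x. x \<in> S \<Longrightarrow> \<bar>f x\<bar> < M"
  shows "continuous_on S (\<lambda>x. Y (f x))"
  by (rule continuous_on_compose2[OF Y_cont assms(1)]) (use assms(2) in force)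

lemma den_continuous_on [continuous_intros]:
  assumes "continuous_on S f" "\<And>x. x \<in> S \<Longrightarrow> \<bar>f x\<bar> < M"
  shows "continuous_on S (\<lambda>x. den (f x))"
  unfolding den_def by (intro continuous_intros assms)

lemma abs_mult_cos_less: "\<bar>a * cos \<phi>\<bar> < M" if "0 \<le> a" "a < M"
proof -
  have "\<bar>a * cos \<phi>\<bar> \<le> a * 1"
    using that unfolding abs_mult by (intro mult_mono) auto
  then show ?thesis using that by simp
qed

text \<open>By the mean value theorem \<open>Y v / v\<close> is a slope \<open>1 / den z\<close>
  with \<open>z\<close> in between, and \<open>den\<close> strictly decreases. This is the convexity
  of \<open>Y\<close> in the form used for the distance from the origin.\<close>

lemma Y_less_tangent: "Y v < v / den v" if "0 < v" "v < M"
proof -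
  have "\<exists>z>0. z < v \<and> Y v - Y 0 = (v - 0) * (1 / den z)"
    by (rule MVT2) (use that in \<open>auto intro!: Y_deriv\<close>)
  then obtain z where z: "0 < z" "z < v" "Y v - Y 0 = (v - 0) * (1 / den z)"
    by blast
  then have "Y v = v / den z" by simp
  also have "\<dots> < v / den v"
    using den_less[of z v] den_pos[of v] den_pos[of z] z that
    by (intro divide_strict_left_mono) auto
  finally show ?thesis .
qed

end

section \<open>The candidate curves\<close>

text \<open>The curve with parameter \<open>a\<close>, which plays the role of \<open>c\<^sub>1 A\<close>, is parametrized by
  \<open>\<phi> = - \<gamma>\<close>; its radius of curvature is \<open>rad\<close>.\<close>

locale candidate = dawson +
  fixes a :: real
  assumes a_pos: "0 < a" and a_less: "a < M"
begin

definition yc :: "real \<Rightarrow> real" where "yc \<phi> = Y (a * cos \<phi>)"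
definition rad :: "real \<Rightarrow> real" where "rad \<phi> = a / den (a * cos \<phi>)"
definition xc :: "real \<Rightarrow> real" where "xc = primitive (\<lambda>\<phi>. rad \<phi> * cos \<phi>)"
definition curve :: "(real \<times> real) set" where "curve = range (\<lambda>\<phi>. (xc \<phi>, yc \<phi>))"
text \<open>Half the length of the diameter: at \<open>pi / 2\<close> the curve meets the
  x-axis.\<close>

definition W :: real where "W = xc (pi / 2)"

lemma a_cos_less: "\<bar>a * cos \<phi>\<bar> < M"
  using a_pos a_less by (intro abs_mult_cos_less) auto

lemma rad_ge: "rad \<phi> \<ge> a"
  using den_pos[OF a_cos_less, of \<phi>] den_le_1[OF a_cos_less, of \<phi>] a_pos
  by (simp add: rad_def field_simps)

lemma rad_pos: "rad \<phi> > 0"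
  using rad_ge[of \<phi>] a_pos by simp

lemma rad_cont: "continuous_on S rad"
  unfolding rad_def
  by (intro continuous_intros ballI den_nz a_cos_less)

section \<open>Symmetries and closedness of the candidate curve\<close>

lemma rad_minus: "rad (- \<phi>) = rad \<phi>"
  by (simp add: rad_def)

lemma rad_pi_minus: "rad (pi - \<phi>) = rad \<phi>"
  using den_even[OF a_cos_less, of \<phi>] by (simp add: rad_def)

lemma rad_pi_plus: "rad (\<phi> + pi) = rad \<phi>"
  using den_even[OF a_cos_less, of \<phi>] by (simp add: rad_def)

lemma yc_deriv [derivative_intros]: "(yc has_real_derivative - rad \<phi> * sin \<phi>) (at \<phi>)"
proof -
  have "((\<lambda>\<phi>. Y (a * cos \<phi>)) has_real_derivative 1 / den (a * cos \<phi>) * (a * - sin \<phi>)) (at \<phi>)"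
    by (rule Y_deriv', rule a_cos_less) (auto intro!: derivative_eq_intros)
  then show ?thesis by (simp add: yc_def[abs_def] rad_def)
qed

lemma xc_0 [simp]: "xc 0 = 0"
  unfolding xc_def by (intro primitive_0 continuous_intros rad_cont)

lemma xc_deriv [derivative_intros]: "(xc has_real_derivative rad \<phi> * cos \<phi>) (at \<phi>)"
  unfolding xc_def by (intro primitive_deriv continuous_intros rad_cont)

lemmas xc_deriv' = DERIV_chain2[OF xc_deriv]

lemma xc_cont: "continuous_on S xc" and yc_cont: "continuous_on S yc"
  by (intro continuous_at_imp_continuous_on ballI DERIV_isCont[OF xc_deriv] DERIV_isCont[OF yc_deriv])+

lemma xc_minus: "xc (- \<phi>) = - xc \<phi>"
  unfolding xc_def by (intro primitive_odd continuous_intros rad_cont) (simp add: rad_minus)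

lemma yc_minus: "yc (- \<phi>) = yc \<phi>"
  by (simp add: yc_def)

lemma yc_pi_plus: "yc (\<phi> + pi) = - yc \<phi>"
  using Y_odd[OF a_cos_less, of \<phi>] by (simp add: yc_def)

text \<open>Reflection in the x-axis: both sides have the same derivative and agree at
  \<open>pi / 2\<close>. With the oddness of \<open>xc\<close> this gives the symmetry under a half
  turn, and two half turns close the curve.\<close>

lemma xc_pi_minus: "xc (pi - \<phi>) = xc \<phi>"
proof -
  have "((\<lambda>\<phi>. xc (pi - \<phi>) - xc \<phi>) has_real_derivative
      rad (pi - \<phi>) * cos (pi - \<phi>) * (- 1) - rad \<phi> * cos \<phi>) (at \<phi>)" for \<phi>
    by (intro derivative_intros xc_deriv') (auto intro!: derivative_eq_intros)
  then have "\<forall>\<phi>. ((\<lambda>\<phi>. xc (pi - \<phi>) - xc \<phi>) has_real_derivative 0) (at \<phi>)"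
    by (simp add: rad_pi_minus)
  from DERIV_isconst_all[OF this, of \<phi> "pi / 2"] show ?thesis by simp
qed

lemma xc_pi_plus: "xc (\<phi> + pi) = - xc \<phi>"
  using xc_pi_minus[of "- \<phi>"] by (simp add: xc_minus add.commute)

lemma periodic: "xc (\<phi> + 2 * pi) = xc \<phi>" "yc (\<phi> + 2 * pi) = yc \<phi>"
  using xc_pi_plus[of \<phi>] xc_pi_plus[of "\<phi> + pi"] yc_pi_plus[of \<phi>] yc_pi_plus[of "\<phi> + pi"]
  by (simp_all add: add.assoc)

lemma yc_pos: "yc \<phi> > 0" if "cos \<phi> > 0"
  unfolding yc_def using a_cos_less[of \<phi>] a_pos that by (intro Y_pos) auto

lemma yc_half_pi [simp]: "yc (pi / 2) = 0"
  by (simp add: yc_def)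

lemma abs_reduce_pi:
  fixes n :: int
  shows "\<bar>xc (\<phi> + n * pi)\<bar> = \<bar>xc \<phi>\<bar> \<and> \<bar>yc (\<phi> + n * pi)\<bar> = \<bar>yc \<phi>\<bar> \<and>
         \<bar>cos (\<phi> + n * pi)\<bar> = \<bar>cos \<phi>\<bar> \<and> xc (\<phi> + n * pi) * sin (\<phi> + n * pi) = xc \<phi> * sin \<phi>"
proof (induction n rule: int_induct[where k = 0])
  case (step1 i)
  have *: "\<phi> + of_int (i + 1) * pi = (\<phi> + i * pi) + pi" by (simp add: algebra_simps)
  show ?case unfolding * using step1 by (simp add: xc_pi_plus yc_pi_plus)
next
  case (step2 i)
  have *: "\<phi> + of_int i * pi = (\<phi> + (i - 1) * pi) + pi" by (simp add: algebra_simps)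
  show ?case using step2(2) unfolding * by (simp add: xc_pi_plus yc_pi_plus)
qed auto

section \<open>Monotonicity along the curve, reduction to one quadrant, and distance from the
  origin\<close>

lemma xc_less: "xc \<phi> < xc \<psi>" if "- (pi / 2) \<le> \<phi>" "\<phi> < \<psi>" "\<psi> \<le> pi / 2"
proof (rule DERIV_pos_imp_increasing_open[OF that(2)])
  fix z assume "\<phi> < z" "z < \<psi>"
  then have "cos z > 0" using that by (intro cos_gt_zero_pi) auto
  then show "\<exists>d. (xc has_real_derivative d) (at z) \<and> 0 < d"
    using xc_deriv[of z] rad_pos[of z] by (intro exI[of _ "rad z * cos z"]) auto
qed (rule xc_cont)

lemma xc_pos: "xc \<phi> > 0" if "0 < \<phi>" "\<phi> < pi"
proof (cases "\<phi> \<le> pi / 2")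
  case True
  then show ?thesis using xc_less[of 0 \<phi>] that by simp
next
  case False
  then show ?thesis using xc_less[of 0 "pi - \<phi>"] xc_pi_minus[of \<phi>] that by simp
qed

lemma first_quadrant_nonneg:
  assumes "0 \<le> \<psi>" "\<psi> \<le> pi / 2"
  shows "xc \<psi> \<ge> 0" "yc \<psi> \<ge> 0" "cos \<psi> \<ge> 0" "sin \<psi> \<ge> 0"
proof -
  show "xc \<psi> \<ge> 0" using xc_pos[of \<psi>] assms by (cases "\<psi> = 0") auto
  show "yc \<psi> \<ge> 0"
  proof (cases "\<psi> = pi / 2")
    case False
    then show ?thesis using yc_pos[of \<psi>] cos_gt_zero_pi[of \<psi>] assms by auto
  qed (simp only: yc_half_pi)
qed (use assms in \<open>auto intro: cos_ge_zero sin_ge_zero\<close>)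

text \<open>A half turn flips the signs of both coordinates, of \<open>cos\<close> and of
  \<open>sin\<close>, and negating the parameter flips those of \<open>xc\<close> and
  \<open>sin\<close> only. The listed quantities survive both, so estimates need only be proved on
  one quarter of the curve.\<close>

lemma first_quadrant:
  obtains \<psi> where "0 \<le> \<psi>" "\<psi> \<le> pi / 2" "\<bar>xc \<phi>\<bar> = xc \<psi>" "\<bar>yc \<phi>\<bar> = yc \<psi>"
    "\<bar>cos \<phi>\<bar> = cos \<psi>" "xc \<phi> * sin \<phi> = xc \<psi> * sin \<psi>"
proof
  \<comment> \<open>The nearest half turn; the remainder lies within \<open>pi / 2\<close> of zero
    and is then folded by its absolute value.\<close>
  define n where "n = \<lfloor>\<phi> / pi + 1 / 2\<rfloor>"
  define \<delta> where "\<delta> = \<phi> - n * pi"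
  have "of_int n \<le> \<phi> / pi + 1 / 2" "\<phi> / pi + 1 / 2 < of_int n + 1"
    unfolding n_def by linarith+
  then have \<delta>: "- (pi / 2) \<le> \<delta>" "\<delta> \<le> pi / 2"
    by (auto simp: \<delta>_def field_simps)
  then show range: "0 \<le> \<bar>\<delta>\<bar>" "\<bar>\<delta>\<bar> \<le> pi / 2" by auto
  have \<phi>: "\<phi> = \<delta> + n * pi" by (simp add: \<delta>_def)
  have 1: "\<bar>xc \<delta>\<bar> = \<bar>xc \<bar>\<delta>\<bar>\<bar>" "\<bar>yc \<delta>\<bar> = \<bar>yc \<bar>\<delta>\<bar>\<bar>"
      "\<bar>cos \<delta>\<bar> = \<bar>cos \<bar>\<delta>\<bar>\<bar>" "xc \<delta> * sin \<delta> = xc \<bar>\<delta>\<bar> * sin \<bar>\<delta>\<bar>"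
    by (cases "\<delta> \<ge> 0"; simp add: xc_minus yc_minus)+
  show "\<bar>xc \<phi>\<bar> = xc \<bar>\<delta>\<bar>" "\<bar>yc \<phi>\<bar> = yc \<bar>\<delta>\<bar>"
    "\<bar>cos \<phi>\<bar> = cos \<bar>\<delta>\<bar>" "xc \<phi> * sin \<phi> = xc \<bar>\<delta>\<bar> * sin \<bar>\<delta>\<bar>"
    using abs_reduce_pi[of \<delta> n] 1 first_quadrant_nonneg[OF range] unfolding \<phi>
    by (metis abs_of_nonneg)+
qed

lemma W_pos: "W > 0"
  unfolding W_def by (rule xc_pos) auto

text \<open>The difference of the sides is the radial speed of the curve up to a positive factor.
  \<open>rad\<close> does not increase on the quadrant, so
  \<open>xc \<phi> \<ge> rad \<phi> * sin \<phi>\<close>, while \<open>Y_less_tangent\<close> gives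
  \<open>yc \<phi> < rad \<phi> * cos \<phi>\<close>.\<close>

lemma xc_tangent: "xc \<phi> * cos \<phi> > yc \<phi> * sin \<phi>" if "0 < \<phi>" "\<phi> < pi / 2"
proof -
  have cos: "cos \<phi> > 0" using that by (intro cos_gt_zero_pi) auto
  have sin: "sin \<phi> > 0" using that by (intro sin_gt_zero) auto
  have "xc 0 - rad \<phi> * sin 0 \<le> xc \<phi> - rad \<phi> * sin \<phi>"
  proof (rule DERIV_nonneg_imp_nondecreasing[of 0 \<phi> "\<lambda>z. xc z - rad \<phi> * sin z"])
    fix z assume z: "0 \<le> z" "z \<le> \<phi>"
    have "cos z \<ge> cos \<phi>" using z that by (intro cos_monotone_0_pi_le) auto
    then have c: "0 \<le> a * cos \<phi>" "a * cos \<phi> \<le> a * cos z" "a * cos z < M"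
      using cos a_pos a_cos_less[of z] by auto
    have "den (a * cos z) \<le> den (a * cos \<phi>)"
      using den_less[OF c(1) _ c(3)] c(2) by (cases "a * cos \<phi> = a * cos z") auto
    then have "rad \<phi> \<le> rad z"
      using den_pos[OF a_cos_less] a_pos by (auto simp: rad_def intro!: divide_left_mono)
    then have "(rad z - rad \<phi>) * cos z \<ge> 0"
      using \<open>cos z \<ge> cos \<phi>\<close> cos by simp
    moreover have "((\<lambda>z. xc z - rad \<phi> * sin z) has_real_derivative (rad z - rad \<phi>) * cos z) (at z)"
      by (auto intro!: derivative_eq_intros simp: algebra_simps)
    ultimately show "\<exists>d. ((\<lambda>z. xc z - rad \<phi> * sin z) has_real_derivative d) (at z) \<and> 0 \<le> d"
      by blast
  qed (use that in simp)
  then have "rad \<phi> * sin \<phi> * cos \<phi> \<le> xc \<phi> * cos \<phi>"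
    using cos by (intro mult_right_mono) auto
  moreover have "yc \<phi> < rad \<phi> * cos \<phi>"
    using Y_less_tangent[of "a * cos \<phi>"] a_cos_less[of \<phi>] a_pos cos
    by (simp add: yc_def rad_def)
  then have "yc \<phi> * sin \<phi> < rad \<phi> * cos \<phi> * sin \<phi>"
    using sin by (intro mult_strict_right_mono)
  ultimately show ?thesis by (simp add: mult_ac)
qed

lemma norm_less_W:
  assumes "0 \<le> \<phi>" "\<phi> < pi / 2"
  shows "(xc \<phi>)\<^sup>2 + (yc \<phi>)\<^sup>2 < W\<^sup>2"
proof -
  have "(xc \<phi>)\<^sup>2 + (yc \<phi>)\<^sup>2 < (xc (pi / 2))\<^sup>2 + (yc (pi / 2))\<^sup>2"
  proof (rule DERIV_pos_imp_increasing_open[OF assms(2)])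
    fix z assume z: "\<phi> < z" "z < pi / 2"
    have "((\<lambda>\<phi>. (xc \<phi>)\<^sup>2 + (yc \<phi>)\<^sup>2) has_real_derivative
           2 * rad z * (xc z * cos z - yc z * sin z)) (at z)"
      by (auto intro!: derivative_eq_intros simp: algebra_simps)
    moreover have "xc z * cos z - yc z * sin z > 0"
      using xc_tangent[of z] z assms by simp
    ultimately show "\<exists>d. ((\<lambda>\<phi>. (xc \<phi>)\<^sup>2 + (yc \<phi>)\<^sup>2) has_real_derivative d) (at z) \<and> 0 < d"
      using rad_pos[of z] by (meson mult_pos_pos zero_less_numeral)
  qed (intro continuous_intros xc_cont yc_cont)
  then show ?thesis by (simp add: W_def)
qed

section \<open>The enclosed region\<close>

definition xinv :: "real \<Rightarrow> real" where "xinv = inv_into {-(pi/2)..pi/2} xc"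
text \<open>Height of the upper arc over \<open>x\<close>, meaningful for
  \<open>\<bar>x\<bar> \<le> W\<close>.\<close>

definition v :: "real \<Rightarrow> real" where "v x = yc (xinv x)"

lemma xc_inj: "inj_on xc {-(pi/2)..pi/2}"
  by (rule linorder_inj_onI) (auto dest!: xc_less)

lemma xinv_xc: "xinv (xc \<phi>) = \<phi>" if "\<bar>\<phi>\<bar> \<le> pi / 2"
  unfolding xinv_def using that by (intro inv_into_f_f xc_inj) auto

lemma v_xc: "v (xc \<phi>) = yc \<phi>" if "\<bar>\<phi>\<bar> \<le> pi / 2"
  by (simp add: v_def xinv_xc[OF that])

lemma
  assumes "\<bar>x\<bar> \<le> W"
  shows xc_xinv: "xc (xinv x) = x" and xinv_bound: "\<bar>xinv x\<bar> \<le> pi / 2"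
proof -
  have "\<exists>\<phi>. - (pi / 2) \<le> \<phi> \<and> \<phi> \<le> pi / 2 \<and> xc \<phi> = x"
    by (rule IVT) (use assms xc_deriv in \<open>auto simp: xc_minus W_def intro: DERIV_isCont\<close>)
  then obtain \<phi> where \<phi>: "\<bar>\<phi>\<bar> \<le> pi / 2" "xc \<phi> = x" by (metis abs_le_iff minus_le_iff)
  then show "xc (xinv x) = x" "\<bar>xinv x\<bar> \<le> pi / 2"
    using xinv_xc[OF \<phi>(1)] by auto
qed

lemma xinv_less_half_pi: "\<bar>xinv x\<bar> < pi / 2" if "\<bar>x\<bar> < W"
proof -
  have "xinv x \<noteq> pi / 2" "xinv x \<noteq> - (pi / 2)"
    using xc_xinv[of x] that W_pos by (smt (verit) W_def xc_minus)+
  then show ?thesis using xinv_bound[of x] that by auto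
qed

lemma v_even: "v (- x) = v x" if "\<bar>x\<bar> \<le> W"
  using v_xc[of "- xinv x"] v_xc[of "xinv x"] xinv_bound[OF that] xc_xinv[OF that]
  by (simp add: xc_minus yc_minus)

lemma v_W: "v W = 0" "v (- W) = 0"
  using v_xc[of "pi / 2"] v_even[of W] W_pos by (auto simp: W_def)

lemma v_end: "v x = 0" if "\<bar>x\<bar> = W"
  using v_W that by (cases "x = W"; cases "x = - W") auto

lemma v_pos: "v x > 0" if "\<bar>x\<bar> < W"
  unfolding v_def using xinv_less_half_pi[OF that] by (intro yc_pos cos_gt_zero_pi) auto

lemma v_nonneg: "v x \<ge> 0" if "\<bar>x\<bar> \<le> W"
  using v_end[of x] v_pos[of x] that by (cases "\<bar>x\<bar> = W") auto

lemma v_cont: "continuous_on {-W..W} v"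
proof -
  have "xc ` {-(pi/2)..pi/2} = {-W..W}"
  proof safe
    fix \<phi> assume "\<phi> \<in> {-(pi/2)..pi/2}"
    then have "xc (- (pi / 2)) \<le> xc \<phi>" "xc \<phi> \<le> xc (pi / 2)"
      using xc_less[of "- (pi / 2)" \<phi>] xc_less[of \<phi> "pi / 2"]
      unfolding atLeastAtMost_iff by (smt (verit))+
    then show "xc \<phi> \<in> {-W..W}" by (auto simp: W_def xc_minus)
  next
    fix x assume "x \<in> {-W..W}"
    then have "\<bar>x\<bar> \<le> W" by auto
    then show "x \<in> xc ` {-(pi/2)..pi/2}"
      using xc_xinv[of x] xinv_bound[of x] by (intro image_eqI[of _ _ "xinv x"]) auto
  qed
  moreover have "continuous_on (xc ` {-(pi/2)..pi/2}) xinv"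
    by (rule continuous_on_inv) (auto intro!: xc_cont xinv_xc)
  ultimately have "continuous_on {-W..W} xinv" by simp
  then show ?thesis unfolding v_def[abs_def]
    by (intro continuous_on_compose2[OF yc_cont[of UNIV]]) auto
qed

lemma v_deriv:
  assumes "\<bar>x\<bar> < W"
  shows "(v has_real_derivative - tan (xinv x)) (at x)"
proof -
  let ?\<phi> = "xinv x"
  have cos: "cos ?\<phi> > 0"
    using xinv_less_half_pi[OF assms] by (intro cos_gt_zero_pi) auto
  have "isCont xinv (xc ?\<phi>)"
    by (rule isCont_inverse_function2[of "-(pi/2)" _ "pi/2"])
      (use xinv_less_half_pi[OF assms] xinv_xc xc_deriv in \<open>auto intro: DERIV_isCont\<close>)
  then have cont: "isCont xinv x" using xc_xinv[of x] assms by simp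
  have "(xinv has_real_derivative inverse (rad ?\<phi> * cos ?\<phi>)) (at x)"
    by (rule DERIV_inverse_function[OF xc_deriv _ _ _ _ cont, of "-W" W])
      (use rad_pos[of ?\<phi>] cos assms xc_xinv in auto)
  then have "((\<lambda>x. yc (xinv x)) has_real_derivative
      - rad ?\<phi> * sin ?\<phi> * inverse (rad ?\<phi> * cos ?\<phi>)) (at x)"
    by (rule DERIV_chain2[OF yc_deriv])
  moreover have "- rad ?\<phi> * sin ?\<phi> * inverse (rad ?\<phi> * cos ?\<phi>) = - tan ?\<phi>"
    using rad_pos[of ?\<phi>] cos by (simp add: tan_def field_simps)
  ultimately show ?thesis by (simp add: v_def[abs_def])
qed

lemma xinv_mono: "xinv x \<le> xinv x'" if "x \<le> x'" "\<bar>x\<bar> \<le> W" "\<bar>x'\<bar> \<le> W"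
  using xc_less[of "xinv x'" "xinv x"] xc_xinv[of x] xc_xinv[of x'] xinv_bound[of x]
    xinv_bound[of x'] that by (smt (verit))

text \<open>The slope of \<open>v\<close> is \<open>- tan (xinv x)\<close>, and both
  \<open>xinv\<close> and \<open>tan\<close> increase on the ranges concerned.\<close>

lemma v_concave: "concave_on {-W<..<W} v"
  unfolding concave_on_def
proof (rule convex_on_realI)
  show "((\<lambda>x. - v x) has_real_derivative tan (xinv x)) (at x)" if "x \<in> {-W<..<W}" for x
    using DERIV_minus[OF v_deriv[of x]] that by auto
  fix x x' assume x: "x \<in> {-W<..<W}" "x' \<in> {-W<..<W}" "x \<le> x'"
  then have "xinv x \<le> xinv x'" by (intro xinv_mono) auto
  moreover have "\<bar>xinv x\<bar> < pi / 2" "\<bar>xinv x'\<bar> < pi / 2"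
    by (rule xinv_less_half_pi; use x in auto)+
  ultimately show "tan (xinv x) \<le> tan (xinv x')"
    using tan_monotone[of "xinv x" "xinv x'"] by (smt (verit))
qed simp

text \<open>Shrinking towards the origin moves boundary points into the open region. Strictness
  comes from \<open>v 0 > 0\<close> in the concavity inequality, and at
  \<open>\<bar>x\<bar> = W\<close> from \<open>v x = 0\<close>.\<close>

lemma v_scale: "v (t * x) > t * v x" if "\<bar>x\<bar> \<le> W" "0 \<le> t" "t < 1"
proof (cases "\<bar>x\<bar> < W")
  case True
  have "convex_on {-W<..<W} (\<lambda>x. - v x)" using v_concave by (simp add: concave_on_def)
  from convex_onD[OF this, of t 0 x] have "t * v x + (1 - t) * v 0 \<le> v (t * x)"
    using True that W_pos by (auto simp: algebra_simps abs_less_iff)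
  moreover have "(1 - t) * v 0 > 0" using v_pos[of 0] W_pos that by simp
  ultimately show ?thesis by linarith
next
  case False
  then have "v x = 0" using that v_end by simp
  moreover have "\<bar>t * x\<bar> < W"
    using False that W_pos by (simp add: abs_mult)
  ultimately show ?thesis using v_pos by simp
qed

lemma v_antimono: "v x' \<le> v x" if "\<bar>x\<bar> \<le> \<bar>x'\<bar>" "\<bar>x'\<bar> \<le> W"
proof -
  have abs: "v z = v \<bar>z\<bar>" if "\<bar>z\<bar> \<le> W" for z
    using v_even[OF that] by (simp add: abs_if)
  show ?thesis
  proof (cases "\<bar>x\<bar> = \<bar>x'\<bar>")
    case False
    let ?h = "xinv \<bar>x\<bar>" and ?h' = "xinv \<bar>x'\<bar>"
    have "xinv 0 = 0" using xinv_xc[of 0] by simp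
    then have "0 \<le> ?h" "?h \<le> ?h'" "?h' \<le> pi / 2"
      using xinv_mono[of 0 "\<bar>x\<bar>"] xinv_mono[of "\<bar>x\<bar>" "\<bar>x'\<bar>"] xinv_bound[of "\<bar>x'\<bar>"] that W_pos
      by auto
    then have "cos ?h' \<le> cos ?h" by (intro cos_monotone_0_pi_le) auto
    then have "a * cos ?h' \<le> a * cos ?h" using a_pos by simp
    then have "yc ?h' \<le> yc ?h"
      using Y_less[OF a_cos_less a_cos_less, of ?h' ?h] unfolding yc_def
      by (cases "a * cos ?h' = a * cos ?h") auto
    then show ?thesis using abs[of x] abs[of x'] that by (simp add: v_def)
  next
    case True
    then show ?thesis using abs[of x] abs[of x'] that by simp
  qed
qed

section \<open>Convexity, closure and frontier of the region\<close>

definition region :: "(real \<times> real) set" where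
  "region = {(x, z). \<bar>x\<bar> < W \<and> \<bar>z\<bar> < v x}"

lemma curve_point: "\<bar>xc \<phi>\<bar> \<le> W" "v (xc \<phi>) = \<bar>yc \<phi>\<bar>"
proof -
  obtain \<psi> where \<psi>: "0 \<le> \<psi>" "\<psi> \<le> pi / 2" "\<bar>xc \<phi>\<bar> = xc \<psi>" "\<bar>yc \<phi>\<bar> = yc \<psi>"
    using first_quadrant by blast
  then show le: "\<bar>xc \<phi>\<bar> \<le> W"
    using xc_less[of \<psi> "pi / 2"] by (cases "\<psi> = pi / 2") (auto simp: W_def)
  have "v (xc \<phi>) = v \<bar>xc \<phi>\<bar>" using v_even[OF le] by (simp add: abs_if)
  then show "v (xc \<phi>) = \<bar>yc \<phi>\<bar>" using v_xc[of \<psi>] \<psi> by simp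
qed

lemma curve_eq: "curve = {(x, z). \<bar>x\<bar> \<le> W \<and> \<bar>z\<bar> = v x}"
proof safe
  fix x z assume "(x, z) \<in> curve"
  then obtain \<phi> where "x = xc \<phi>" "z = yc \<phi>" by (auto simp: curve_def)
  then show "\<bar>x\<bar> \<le> W" "\<bar>z\<bar> = v x" using curve_point[of \<phi>] by auto
next
  fix x z assume x: "\<bar>x\<bar> \<le> W" "\<bar>z\<bar> = v x"
  have x': "xc (xinv x) = x" using xc_xinv x by blast
  consider "z = yc (xinv x)" | "z = - yc (xinv x)"
    using x(2) by (auto simp: v_def abs_if split: if_splits)
  then show "(x, z) \<in> curve"
  proof cases
    case 1
    then show ?thesis using x' by (auto simp: curve_def intro!: image_eqI[of _ _ "xinv x"])
  next
    case 2
    \<comment> \<open>The reflected parameter reaches the lower arc.\<close>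
    have "(x, z) = (xc (pi - xinv x), yc (pi - xinv x))"
      using x' 2 yc_pi_plus[of "- xinv x"] by (simp add: xc_pi_minus yc_minus)
    then show ?thesis by (auto simp: curve_def)
  qed
qed

lemma region_convex: "convex region"
proof (rule convexI)
  fix p q :: "real \<times> real" and s t :: real
  assume pq: "p \<in> region" "q \<in> region" and st: "0 \<le> s" "0 \<le> t" "s + t = 1"
  obtain x z x' z' where [simp]: "p = (x, z)" "q = (x', z')" by (metis surj_pair)
  have x: "x \<in> {-W<..<W}" "x' \<in> {-W<..<W}" "\<bar>z\<bar> < v x" "\<bar>z'\<bar> < v x'"
    using pq by (auto simp: region_def)
  have "s *\<^sub>R x + t *\<^sub>R x' \<in> {-W<..<W}"
    by (rule convexD) (use x st in auto)
  then have 1: "\<bar>s * x + t * x'\<bar> < W" by auto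
  have "convex_on {-W<..<W} (\<lambda>x. - v x)" using v_concave by (simp add: concave_on_def)
  then have "- v (s *\<^sub>R x + t *\<^sub>R x') \<le> s * - v x + t * - v x'"
    using x st unfolding convex_on_def by blast
  then have 2: "s * v x + t * v x' \<le> v (s * x + t * x')" by simp
  have "\<bar>s * z + t * z'\<bar> \<le> s * \<bar>z\<bar> + t * \<bar>z'\<bar>"
    using abs_triangle_ineq[of "s * z" "t * z'"] st by (simp add: abs_mult)
  also have "\<dots> < s * v x + t * v x'"
  proof (cases "s = 0")
    case False
    then have "s * \<bar>z\<bar> < s * v x" using x st by simp
    moreover have "t * \<bar>z'\<bar> \<le> t * v x'" using x st by (intro mult_left_mono) auto
    ultimately show ?thesis by linarith
  qed (use x st in simp)
  finally show "s *\<^sub>R p + t *\<^sub>R q \<in> region"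
    using 1 2 by (simp add: region_def)
qed

definition closed_region :: "(real \<times> real) set" where
  "closed_region = {(x, z). \<bar>x\<bar> \<le> W \<and> \<bar>z\<bar> \<le> v x}"

lemma closed_region_closed: "closed closed_region"
proof -
  have eq: "closed_region = ({-W..W} \<times> UNIV) \<inter> (\<lambda>p. \<bar>snd p\<bar> - v (fst p)) -` {..0}"
    by (auto simp: closed_region_def)
  have "continuous_on ({-W..W} \<times> UNIV) (\<lambda>p::real\<times>real. \<bar>snd p\<bar> - v (fst p))"
    by (intro continuous_intros continuous_on_compose2[OF v_cont]) auto
  then show ?thesis unfolding eq
    by (intro continuous_closed_preimage) (auto intro: closed_Times)
qed

lemma region_open: "open region"
proof -
  have eq: "region = ({-W<..<W} \<times> UNIV) \<inter> (\<lambda>p. \<bar>snd p\<bar> - v (fst p)) -` {..<0}"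
    by (auto simp: region_def)
  have "continuous_on ({-W<..<W} \<times> UNIV) (\<lambda>p::real\<times>real. \<bar>snd p\<bar> - v (fst p))"
    by (intro continuous_intros continuous_on_compose2[OF v_cont]) auto
  then show ?thesis unfolding eq
    by (intro continuous_open_preimage) (auto intro: open_Times)
qed

lemma region_closure: "closure region = closed_region"
proof (rule antisym)
  show "closure region \<subseteq> closed_region"
    by (rule closure_minimal[OF _ closed_region_closed]) (auto simp: region_def closed_region_def)
  show "closed_region \<subseteq> closure region"
  proof
    fix p assume p: "p \<in> closed_region"
    obtain x z where [simp]: "p = (x, z)" by fastforce
    have x: "\<bar>x\<bar> \<le> W" "\<bar>z\<bar> \<le> v x" using p by (auto simp: closed_region_def)
    \<comment> \<open>Factors below 1 that tend to 1: the shrunken points lie in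
      \<open>region\<close> by \<open>v_scale\<close> and converge to \<open>p\<close>.\<close>
    define t :: "nat \<Rightarrow> real" where "t n = 1 - 1 / (real n + 1)" for n
    have t: "0 \<le> t n" "t n < 1" for n by (auto simp: t_def field_simps)
    have "t n *\<^sub>R p \<in> region" for n
    proof -
      have "\<bar>t n * x\<bar> < W"
      proof (cases "x = 0")
        case False
        then have "t n * \<bar>x\<bar> < 1 * \<bar>x\<bar>" using t by (intro mult_strict_right_mono) auto
        then show ?thesis using t[of n] x by (simp add: abs_mult)
      qed (use W_pos in simp)
      moreover have "\<bar>t n * z\<bar> \<le> t n * v x"
        using t[of n] x by (simp add: abs_mult mult_left_mono)
      ultimately show ?thesis
        using v_scale[OF x(1) t(1)[of n] t(2)[of n]] by (simp add: region_def)
    qed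
    moreover have "(\<lambda>n. t n *\<^sub>R p) \<longlonglongrightarrow> 1 *\<^sub>R p"
    proof (intro tendsto_scaleR tendsto_const)
      have "(\<lambda>n. 1 - inverse (real (Suc n))) \<longlonglongrightarrow> 1 - 0"
        by (intro tendsto_diff tendsto_const LIMSEQ_inverse_real_of_nat)
      then show "t \<longlonglongrightarrow> 1" by (simp add: t_def[abs_def] inverse_eq_divide add.commute)
    qed
    ultimately show "p \<in> closure region"
      unfolding closure_sequential by (intro exI[of _ "\<lambda>n. t n *\<^sub>R p"]) simp
  qed
qed

lemma region_frontier: "frontier region = curve"
proof -
  have "frontier region = closed_region - region"
    by (simp add: frontier_def region_closure interior_open[OF region_open])
  also have "\<dots> = curve"
  proof -
    have "(x, z) \<in> closed_region - region \<longleftrightarrow> (x, z) \<in> curve" for x z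
      using v_end[of x] by (cases "\<bar>x\<bar> = W") (auto simp: closed_region_def region_def curve_eq)
    then show ?thesis by auto
  qed
  finally show ?thesis .
qed

lemma region_bounded: "bounded region"
proof -
  have "compact (v ` {-W..W})" by (intro compact_continuous_image v_cont compact_Icc)
  then obtain B where B: "\<And>x. x \<in> {-W..W} \<Longrightarrow> \<bar>v x\<bar> \<le> B"
    unfolding compact_eq_bounded_closed bounded_iff real_norm_def by blast
  have "region \<subseteq> {-W..W} \<times> {-B..B}"
  proof
    fix p assume "p \<in> region"
    then show "p \<in> {-W..W} \<times> {-B..B}"
      using B[of "fst p"] by (auto simp: region_def abs_less_iff)
  qed
  then show ?thesis by (rule bounded_subset[rotated]) (intro bounded_Times bounded_closed_interval)
qed

text \<open>For a bounded convex set the inside of its frontier is its interior; here the frontier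
  is the curve and the set is open.\<close>

lemma inside_curve: "inside curve = region"
  using inside_frontier_eq_interior[OF region_bounded region_convex]
  by (simp add: region_frontier interior_open[OF region_open])

lemma curve_convex: "convex_curve curve"
  by (simp add: convex_curve_def inside_curve region_convex)

text \<open>Vertical slices of the region have length \<open>2 * v x\<close>; the substitution
  \<open>x = xc \<phi>\<close> then turns the integral over \<open>x\<close> into one over the
  angle.\<close>

lemma area_curve:
  "enclosed_area curve = integral {-(pi/2)..pi/2} (\<lambda>\<phi>. 2 * yc \<phi> * (rad \<phi> * cos \<phi>))"
proof -
  have "((\<lambda>\<phi>. (rad \<phi> * cos \<phi>) *\<^sub>R (2 * v (xc \<phi>))) has_integral
      integral {xc (-(pi/2))..xc (pi/2)} (\<lambda>x. 2 * v x)) {-(pi/2)..pi/2}"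
  proof (rule has_integral_substitution)
    show "xc ` {-(pi/2)..pi/2} \<subseteq> {-W..W}"
      using curve_point(1) by (auto simp: abs_le_iff minus_le_iff)
    show "xc (-(pi/2)) \<le> xc (pi/2)"
      using W_pos by (simp add: xc_minus W_def)
    show "(xc has_real_derivative rad \<phi> * cos \<phi>) (at \<phi> within {-(pi/2)..pi/2})" for \<phi>
      by (rule has_field_derivative_at_within[OF xc_deriv])
  qed (auto intro!: continuous_intros v_cont)
  then have "integral {-(pi/2)..pi/2} (\<lambda>\<phi>. (rad \<phi> * cos \<phi>) *\<^sub>R (2 * v (xc \<phi>)))
      = integral {-W..W} (\<lambda>x. 2 * v x)"
    by (simp add: integral_unique xc_minus W_def)
  moreover have "integral {-(pi/2)..pi/2} (\<lambda>\<phi>. (rad \<phi> * cos \<phi>) *\<^sub>R (2 * v (xc \<phi>)))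
      = integral {-(pi/2)..pi/2} (\<lambda>\<phi>. 2 * yc \<phi> * (rad \<phi> * cos \<phi>))"
    by (rule integral_cong) (auto simp: v_xc)
  moreover have "emeasure lborel region = ennreal (integral {-W..W} (\<lambda>x. 2 * v x))"
  proof -
    have "region \<in> sets (lborel \<Otimes>\<^sub>M lborel)"
      unfolding lborel_prod using region_open by (simp only: sets_lborel borel_open)
    then have "emeasure lborel region = (\<integral>\<^sup>+x. emeasure lborel (Pair x -` region) \<partial>lborel)"
      using lborel.emeasure_pair_measure_alt[of region lborel] by (simp add: lborel_prod)
    also have "\<dots> = (\<integral>\<^sup>+x. ennreal (2 * v x) * indicator {-W..W} x \<partial>lborel)"
    proof (rule nn_integral_cong)
      fix x
      show "emeasure lborel (Pair x -` region) = ennreal (2 * v x) * indicator {-W..W} x"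
      proof (cases "\<bar>x\<bar> < W")
        case True
        then have "Pair x -` region = {- v x <..< v x}" by (auto simp: region_def)
        then show ?thesis using True v_pos[of x] by (simp add: indicator_def abs_less_iff)
      next
        case False
        then have "Pair x -` region = {}" by (auto simp: region_def)
        \<comment> \<open>At the two ends the slice is empty and the right side vanishes as
          well.\<close>
        moreover have "x \<in> {-W..W} \<Longrightarrow> v x = 0" using False by (intro v_end) auto
        ultimately show ?thesis by (auto simp: indicator_def)
      qed
    qed
    also have "\<dots> = ennreal (integral {-W..W} (\<lambda>x. 2 * v x))"
      by (intro nn_integral_has_integral_lebesgue' integrable_integral
          integrable_continuous_interval continuous_intros v_cont)
        (auto intro!: v_nonneg)
    finally show ?thesis .
  qed
  moreover have "integral {-W..W} (\<lambda>x. 2 * v x) \<ge> 0"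
    by (intro integral_nonneg integrable_continuous_interval continuous_intros v_cont)
      (auto intro!: v_nonneg)
  ultimately show ?thesis
    using region_open by (simp add: enclosed_area_def inside_curve measure_def)
qed

end

section \<open>Smoothness from a differential system\<close>

text \<open>Polynomial expressions in the functions of \<open>B\<close>.\<close>

inductive_set ring_generated :: "(real \<Rightarrow> real) set \<Rightarrow> (real \<Rightarrow> real) set" for B where
  base: "f \<in> B \<Longrightarrow> f \<in> ring_generated B"
| const: "(\<lambda>x. c) \<in> ring_generated B"
| add: "f \<in> ring_generated B \<Longrightarrow> g \<in> ring_generated B \<Longrightarrow> (\<lambda>x. f x + g x) \<in> ring_generated B"
| mult: "f \<in> ring_generated B \<Longrightarrow> g \<in> ring_generated B \<Longrightarrow> (\<lambda>x. f x * g x) \<in> ring_generated B"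

text \<open>By the sum and product rules the ring is closed under differentiation as soon as its
  generators differentiate into it, so all iterated derivatives exist.\<close>

lemma smooth_ring_generated:
  assumes B: "\<And>f. f \<in> B \<Longrightarrow> \<exists>f'\<in>ring_generated B. \<forall>x. (f has_real_derivative f' x) (at x)"
    and f: "f \<in> ring_generated B"
  shows "smooth_fun f"
proof -
  have closed: "\<exists>h'\<in>ring_generated B. \<forall>x. (h has_real_derivative h' x) (at x)"
    if "h \<in> ring_generated B" for h
    using that
  proof induction
    case (const c)
    then show ?case by (intro bexI[of _ "\<lambda>x. 0"] ring_generated.const) auto
  next
    case (add f g)
    then obtain f' g' where "f' \<in> ring_generated B" "g' \<in> ring_generated B"
      "\<forall>x. (f has_real_derivative f' x) (at x)" "\<forall>x. (g has_real_derivative g' x) (at x)" by blast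
    then show ?case
      by (intro bexI[of _ "\<lambda>x. f' x + g' x"] ring_generated.add) (auto intro: DERIV_add)
  next
    case (mult f g)
    then obtain f' g' where "f' \<in> ring_generated B" "g' \<in> ring_generated B"
      "\<forall>x. (f has_real_derivative f' x) (at x)" "\<forall>x. (g has_real_derivative g' x) (at x)" by blast
    then show ?case
      using mult.hyps
      by (intro bexI[of _ "\<lambda>x. f' x * g x + g' x * f x"] ring_generated.add ring_generated.mult)
        (auto intro: DERIV_mult)
  qed (use B in blast)
  have "(deriv ^^ n) f \<in> ring_generated B" for n
  proof (induction n)
    case (Suc n)
    then obtain h' where h': "h' \<in> ring_generated B"
      "\<forall>x. ((deriv ^^ n) f has_real_derivative h' x) (at x)" using closed by blast
    then have "deriv ((deriv ^^ n) f) = h'" by (auto intro: DERIV_imp_deriv)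
    then show ?case using h' by simp
  qed (simp add: f)
  then have "\<exists>h'. \<forall>x. ((deriv ^^ n) f has_real_derivative h' x) (at x)" for n
    using closed by blast
  then show ?thesis
    unfolding smooth_fun_def differentiable_on_def
    by (metis real_differentiable_def)
qed

text \<open>Covers functions outside the ring whose derivative lies in it: the coordinate
  \<open>fst (point s)\<close> and the angle.\<close>

lemma smooth_fun_deriv:
  assumes f: "\<And>x. (f has_real_derivative f' x) (at x)" and "smooth_fun f'"
  shows "smooth_fun f"
  unfolding smooth_fun_def
proof
  fix n
  have "deriv f = f'" using f by (auto intro: DERIV_imp_deriv)
  then show "(deriv ^^ n) f differentiable_on UNIV"
  proof (cases n)
    case 0
    then show ?thesis using f by (auto simp: differentiable_on_def real_differentiable_def)
  next
    case (Suc m)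
    then have "(deriv ^^ n) f = (deriv ^^ m) f'"
      using \<open>deriv f = f'\<close> by (simp add: funpow_Suc_right del: funpow.simps)
    then show ?thesis using assms(2) by (simp add: smooth_fun_def)
  qed
qed

section \<open>Arc length parametrization of the candidates\<close>

text \<open>The step \<open>t * c\<close> points towards zero and is shorter than
  \<open>\<bar>u\<bar>\<close>, so it cannot overshoot. Applied to each coordinate when moving along
  the inward normal.\<close>

lemma abs_diff_less: "\<bar>u - t * c\<bar> < \<bar>u\<bar>"
  if uc: "u * c > 0" and "\<bar>c\<bar> \<le> 1" "0 < t" "t < \<bar>u\<bar>" for u t c :: real
proof -
  have "t * \<bar>c\<bar> \<le> t * 1" using that by (intro mult_left_mono) auto
  then have less: "t * \<bar>c\<bar> < \<bar>u\<bar>" using that by linarith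
  have "c \<noteq> 0" using that(1) by auto
  then have pos: "t * \<bar>c\<bar> > 0" using that by simp
  consider "u > 0" "c > 0" | "u < 0" "c < 0"
    using uc by (auto simp: zero_less_mult_iff)
  then show ?thesis
  proof cases
    case 1
    then show ?thesis using less pos by simp
  next
    case 2
    then show ?thesis using less pos by simp
  qed
qed

context candidate
begin

definition arclen :: "real \<Rightarrow> real" where "arclen = primitive rad"
definition ang :: "real \<Rightarrow> real" where "ang = inv arclen"

lemma arclen_0: "arclen 0 = 0"
  unfolding arclen_def by (rule primitive_0[OF rad_cont])

lemma arclen_deriv: "(arclen has_real_derivative rad \<phi>) (at \<phi>)"
  unfolding arclen_def by (rule primitive_deriv[OF rad_cont])

lemma arclen_less: "arclen \<phi> < arclen \<psi>" if "\<phi> < \<psi>"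
  by (rule DERIV_pos_imp_increasing[OF that]) (use arclen_deriv rad_pos in blast)

lemma arclen_slope: "a * (\<psi> - \<phi>) \<le> arclen \<psi> - arclen \<phi>" if "\<phi> \<le> \<psi>"
proof -
  have "arclen \<phi> - a * \<phi> \<le> arclen \<psi> - a * \<psi>"
  proof (rule DERIV_nonneg_imp_nondecreasing[OF that])
    fix z
    have "((\<lambda>z. arclen z - a * z) has_real_derivative rad z - a) (at z)"
      by (auto intro!: derivative_eq_intros arclen_deriv)
    then show "\<exists>d. ((\<lambda>z. arclen z - a * z) has_real_derivative d) (at z) \<and> 0 \<le> d"
      using rad_ge[of z] by (intro exI[of _ "rad z - a"]) auto
  qed
  then show ?thesis by (simp add: algebra_simps)
qed

lemma arclen_surj: "surj arclen"
proof (rule surjI)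
  fix s
  \<comment> \<open>\<open>arclen\<close> grows at least at rate \<open>a\<close>, so on the
    interval from \<open>- b\<close> to \<open>b\<close> it covers all values up to
    \<open>\<bar>s\<bar>\<close> in modulus.\<close>
  define b where "b = \<bar>s\<bar> / a"
  have b: "b \<ge> 0" "a * b = \<bar>s\<bar>" using a_pos by (auto simp: b_def)
  have "\<exists>\<phi>. - b \<le> \<phi> \<and> \<phi> \<le> b \<and> arclen \<phi> = s"
    by (rule IVT)
      (use arclen_slope[of 0 b] arclen_slope[of "- b" 0] b arclen_0 in
        \<open>auto intro!: DERIV_isCont[OF arclen_deriv]\<close>)
  then have "\<exists>\<phi>. arclen \<phi> = s" by blast
  then show "arclen (SOME \<phi>. arclen \<phi> = s) = s" by (rule someI_ex)
qed

lemma arclen_inj: "inj arclen"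
  by (intro linorder_injI less_imp_neq arclen_less)

lemma arclen_ang: "arclen (ang s) = s" and ang_arclen: "ang (arclen \<phi>) = \<phi>"
  unfolding ang_def by (simp_all add: surj_f_inv_f[OF arclen_surj] inv_f_f[OF arclen_inj])

lemma ang_less: "ang s < ang t" if "s < t"
proof (rule ccontr)
  assume "\<not> ang s < ang t"
  then have "arclen (ang t) \<le> arclen (ang s)"
    using arclen_less[of "ang t" "ang s"] by (cases "ang s = ang t") auto
  then show False using that by (simp add: arclen_ang)
qed

text \<open>This derivative is the curvature \<open>1 / rad\<close>, written as the stationary
  equation solved for it. Being polynomial in \<open>cos (ang s)\<close> and
  \<open>yc (ang s)\<close>, the form suits \<open>smooth_ring_generated\<close>.\<close>

lemma ang_deriv: "(ang has_real_derivative (1 - k * a * cos (ang s) * yc (ang s)) / a) (at s)"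
proof -
  have "isCont ang (arclen (ang s))"
    by (rule isCont_inverse_function2[of "ang s - 1" _ "ang s + 1"])
      (auto simp: ang_arclen intro: DERIV_isCont[OF arclen_deriv])
  then have cont: "isCont ang s" by (simp add: arclen_ang)
  have "(ang has_real_derivative inverse (rad (ang s))) (at s)"
    by (rule DERIV_inverse_function[OF arclen_deriv _ _ _ _ cont, of "s - 1" "s + 1"])
      (use rad_pos[of "ang s"] arclen_ang in auto)
  then show ?thesis
    by (simp add: rad_def den_def yc_def inverse_eq_divide mult_ac)
qed

lemma ang_deriv_rad: "(ang has_real_derivative 1 / rad (ang s)) (at s)"
  using ang_deriv[of s] by (simp add: rad_def den_def yc_def mult_ac)

lemma arclen_periodic: "arclen (\<phi> + 2 * pi) = arclen \<phi> + arclen (2 * pi)"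
proof -
  have "((\<lambda>\<phi>. arclen (\<phi> + 2 * pi) - arclen \<phi>) has_real_derivative rad (\<phi> + 2 * pi) * 1 - rad \<phi>) (at \<phi>)" for \<phi>
    by (intro derivative_intros DERIV_chain2[OF arclen_deriv] arclen_deriv)
      (auto intro!: derivative_eq_intros)
  moreover have "rad (\<phi> + 2 * pi) = rad \<phi>" for \<phi>
    using rad_pi_plus[of \<phi>] rad_pi_plus[of "\<phi> + pi"] by (simp add: add.assoc)
  ultimately have "\<forall>\<phi>. ((\<lambda>\<phi>. arclen (\<phi> + 2 * pi) - arclen \<phi>) has_real_derivative 0) (at \<phi>)"
    by simp
  from DERIV_isconst_all[OF this, of \<phi> 0] show ?thesis by (simp add: arclen_0)
qed

lemma ang_periodic: "ang (s + arclen (2 * pi)) = ang s + 2 * pi"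
  using ang_arclen[of "ang s + 2 * pi"] by (simp add: arclen_periodic arclen_ang)

definition point :: "real \<Rightarrow> real \<times> real" where "point s = (xc (ang s), yc (ang s))"

lemma range_point: "range point = curve"
proof -
  have "range ang = UNIV" using ang_arclen by (rule surjI)
  moreover have "point = (\<lambda>\<phi>. (xc \<phi>, yc \<phi>)) \<circ> ang"
    by (auto simp: point_def)
  ultimately show ?thesis by (simp only: image_comp[symmetric] curve_def)
qed

lemma point_deriv:
  "((\<lambda>s. fst (point s)) has_real_derivative cos (ang s)) (at s)"
  "((\<lambda>s. snd (point s)) has_real_derivative - sin (ang s)) (at s)"
  using DERIV_chain2[OF xc_deriv ang_deriv_rad[of s]] DERIV_chain2[OF yc_deriv ang_deriv_rad[of s]]
    rad_pos[of "ang s"]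
  by (simp_all add: point_def)

text \<open>The height together with \<open>cos\<close> and \<open>sin\<close> of \<open>ang\<close>
  solves a differential system with polynomial right side; the other two functions follow by one
  integration.\<close>

lemma smooth_point:
  "smooth_fun (\<lambda>s. fst (point s))" "smooth_fun (\<lambda>s. snd (point s))" "smooth_fun (\<lambda>s. - ang s)"
proof -
  define y where "y = (\<lambda>s. snd (point s))"
  define C where "C = (\<lambda>s. cos (ang s))"
  define S where "S = (\<lambda>s. sin (ang s))"
  define q where "q = (\<lambda>s. 1 / a + (- k) * (C s * y s))"
  let ?R = "ring_generated {y, C, S}"
  have mem: "y \<in> ?R" "C \<in> ?R" "S \<in> ?R" by (auto intro: ring_generated.base)
  have q: "q \<in> ?R" unfolding q_def
    by (intro ring_generated.add ring_generated.mult ring_generated.const mem)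
  have ang: "(ang has_real_derivative q s) (at s)" for s
    using ang_deriv[of s] a_pos by (simp add: q_def C_def y_def point_def field_simps)
  have d: "(y has_real_derivative (- 1) * S s) (at s)"
    "(C has_real_derivative (- 1) * (S s * q s)) (at s)"
    "(S has_real_derivative C s * q s) (at s)" for s
    using point_deriv(2)[of s] ang[of s]
    by (auto simp: y_def C_def S_def intro!: derivative_eq_intros)
  have smooth: "smooth_fun f" if "f \<in> ?R" for f
  proof (rule smooth_ring_generated[OF _ that])
    fix f assume f: "f \<in> {y, C, S}"
    have "(\<lambda>s. (- 1) * S s) \<in> ?R" "(\<lambda>s. (- 1) * (S s * q s)) \<in> ?R" "(\<lambda>s. C s * q s) \<in> ?R"
      by (intro ring_generated.mult ring_generated.const mem q)+
    note R = this
    consider "f = y" | "f = C" | "f = S" using f by blast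
    then show "\<exists>f'\<in>?R. \<forall>x. (f has_real_derivative f' x) (at x)"
      by cases (use d R in fast)+
  qed
  show "smooth_fun (\<lambda>s. snd (point s))" using smooth[OF mem(1)] by (simp add: y_def)
  show "smooth_fun (\<lambda>s. fst (point s))"
    by (rule smooth_fun_deriv[OF point_deriv(1)]) (use smooth[OF mem(2)] in \<open>simp add: C_def\<close>)
  show "smooth_fun (\<lambda>s. - ang s)"
  proof (rule smooth_fun_deriv)
    show "((\<lambda>s. - ang s) has_real_derivative (- 1) * q s) (at s)" for s
      using DERIV_minus[OF ang[of s]] by simp
  qed (intro smooth ring_generated.mult ring_generated.const q)
qed

section \<open>Simplicity and orientation of the curve\<close>

lemma yc_eq_imp_cos_eq: "cos \<phi> = cos \<psi>" if "yc \<phi> = yc \<psi>"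
proof -
  have "D (yc \<phi>) = D (yc \<psi>)" using that by (rule arg_cong)
  then show ?thesis unfolding yc_def D_Y[OF a_cos_less] using a_pos by simp
qed

text \<open>Equal heights force equal cosines, and \<open>cos\<close> is injective on each half
  period. Parameters in different halves are then mirror images, where \<open>xc\<close> takes
  opposite values that vanish only at multiples of \<open>pi\<close>.\<close>

lemma curve_simple_aux:
  assumes "0 \<le> \<phi>" "\<phi> < \<psi>" "\<psi> < 2 * pi" "xc \<phi> = xc \<psi>" "yc \<phi> = yc \<psi>"
  shows False
proof -
  have cos: "cos \<phi> = cos \<psi>" using yc_eq_imp_cos_eq assms by blast
  have refl: "cos (2 * pi - z) = cos z" for z by simp
  consider "\<psi> \<le> pi" | "\<phi> \<le> pi" "pi < \<psi>" | "pi < \<phi>" using assms by linarith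
  then show False
  proof cases
    case 1
    then show False using cos_inj_pi[of \<phi> \<psi>] cos assms by auto
  next
    case 2
    have \<psi>: "\<phi> = 2 * pi - \<psi>"
      by (rule cos_inj_pi) (use 2 cos refl[of \<psi>] assms in auto)
    then have "\<psi> = - \<phi> + 2 * pi" by simp
    then have "xc \<psi> = - xc \<phi>" by (simp only: periodic xc_minus)
    then show False using xc_pos[of \<phi>] 2 assms \<psi> by (cases "\<phi> = 0"; cases "\<phi> = pi") auto
  next
    case 3
    have "2 * pi - \<phi> = 2 * pi - \<psi>"
      by (rule cos_inj_pi) (use 3 cos assms in auto)
    then show False using assms by simp
  qed
qed

lemma point_inj: "inj_on point {0..<arclen (2 * pi)}"
proof (rule linorder_inj_onI)
  fix s t assume st: "s < t" "s \<in> {0..<arclen (2 * pi)}" "t \<in> {0..<arclen (2 * pi)}"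
  have "ang 0 = 0" using ang_arclen[of 0] by (simp add: arclen_0)
  then have "0 \<le> ang s" "ang s < ang t" "ang t < 2 * pi"
    using ang_less[of 0 s] ang_less[of s t] ang_less[of t "arclen (2 * pi)"] st
    by (cases "s = 0"; auto simp: ang_arclen)+
  then show "point s \<noteq> point t"
    using curve_simple_aux by (auto simp: point_def)
qed auto

text \<open>Each coordinate of the point is zero or has the same sign as the component that the
  normal subtracts. So a short step shrinks the coordinates, and \<open>v\<close> does not decrease
  towards the centre.\<close>

lemma inward_normal:
  "\<forall>\<^sub>F t in at_right 0. (xc \<phi>, yc \<phi>) + t *\<^sub>R (- sin \<phi>, - cos \<phi>) \<in> inside curve"
proof -
  obtain \<psi> where \<psi>: "0 \<le> \<psi>" "\<psi> \<le> pi / 2" "\<bar>xc \<phi>\<bar> = xc \<psi>" "\<bar>yc \<phi>\<bar> = yc \<psi>"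
    "\<bar>cos \<phi>\<bar> = cos \<psi>" "xc \<phi> * sin \<phi> = xc \<psi> * sin \<psi>"
    using first_quadrant by blast
  have xs: "xc \<phi> * sin \<phi> > 0" if "sin \<phi> \<noteq> 0"
  proof -
    have "\<psi> \<noteq> 0"
    proof
      assume "\<psi> = 0"
      then have "\<bar>cos \<phi>\<bar> = 1" using \<psi> by simp
      then have "(cos \<phi>)\<^sup>2 = 1" by (simp add: abs_square_eq_1)
      then show False using that sin_cos_squared_add[of \<phi>] by simp
    qed
    then have "xc \<psi> > 0" "sin \<psi> > 0"
      using \<psi> by (auto intro!: xc_pos sin_gt_zero)
    then show ?thesis unfolding \<psi> by simp
  qed
  show ?thesis
  proof (cases "cos \<phi> = 0")
    case True
    then have h: "\<psi> = pi / 2" using \<psi> cos_gt_zero_pi[of \<psi>] by force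
    have W: "\<bar>xc \<phi>\<bar> = W" "yc \<phi> = 0" using \<psi>(3,4) unfolding h W_def by simp_all
    have "sin \<phi> \<noteq> 0" using True sin_cos_squared_add[of \<phi>] by force
    show ?thesis
    proof (rule eventually_at_rightI[of 0 W])
      fix t assume t: "t \<in> {0<..<W}"
      have "\<bar>xc \<phi> - t * sin \<phi>\<bar> < \<bar>xc \<phi>\<bar>"
        using xs \<open>sin \<phi> \<noteq> 0\<close> t W by (intro abs_diff_less) auto
      then show "(xc \<phi>, yc \<phi>) + t *\<^sub>R (- sin \<phi>, - cos \<phi>) \<in> inside curve"
        using W True v_pos[of "xc \<phi> - t * sin \<phi>"] by (simp add: inside_curve region_def)
    qed (rule W_pos)
  next
    case False
    have ycos: "yc \<phi> * cos \<phi> > 0"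
    proof (cases "cos \<phi> > 0")
      case True
      then show ?thesis using yc_pos[of \<phi>] by simp
    next
      case neg: False
      then have "cos (\<phi> + pi) > 0" using False by simp
      from yc_pos[OF this] have "yc \<phi> < 0" by (simp add: yc_pi_plus)
      then show ?thesis using neg False by (simp add: mult_neg_neg)
    qed
    \<comment> \<open>If \<open>sin \<phi> = 0\<close>, the first coordinate stays fixed and imposes
      no bound; 1 is then a placeholder.\<close>
    define b where "b = min \<bar>yc \<phi>\<bar> (if sin \<phi> = 0 then 1 else \<bar>xc \<phi>\<bar>)"
    show ?thesis
    proof (rule eventually_at_rightI[of 0 b])
      show "0 < b" using ycos xs by (auto simp: b_def)
      fix t assume t: "t \<in> {0<..<b}"
      have y: "\<bar>yc \<phi> - t * cos \<phi>\<bar> < \<bar>yc \<phi>\<bar>"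
        using ycos t by (intro abs_diff_less) (auto simp: b_def)
      have x: "\<bar>xc \<phi> - t * sin \<phi>\<bar> \<le> \<bar>xc \<phi>\<bar>"
      proof (cases "sin \<phi> = 0")
        case False
        then show ?thesis using xs t by (intro less_imp_le[OF abs_diff_less]) (auto simp: b_def)
      qed simp
      have "\<bar>xc \<phi>\<bar> \<noteq> W"
        using v_end[of "xc \<phi>"] curve_point(2)[of \<phi>] ycos by auto
      then have "\<bar>xc \<phi>\<bar> < W" using curve_point(1)[of \<phi>] by simp
      moreover have "v (xc \<phi>) \<le> v (xc \<phi> - t * sin \<phi>)"
        using x curve_point(1) by (intro v_antimono) auto
      ultimately show "(xc \<phi>, yc \<phi>) + t *\<^sub>R (- sin \<phi>, - cos \<phi>) \<in> inside curve"
        using x y curve_point(2)[of \<phi>] by (simp add: inside_curve region_def)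
    qed
  qed
qed

lemma curve_param: "clockwise_arclength_param curve (arclen (2 * pi)) point (\<lambda>s. - ang s)"
  unfolding clockwise_arclength_param_def
proof (intro conjI allI)
  show "arclen (2 * pi) > 0" using arclen_less[of 0 "2 * pi"] by (simp add: arclen_0)
  show "point (s + arclen (2 * pi)) = point s" for s
    by (simp add: point_def ang_periodic periodic)
  show "\<forall>\<^sub>F t in at_right 0. point s + t *\<^sub>R (sin (- ang s), - cos (- ang s)) \<in> inside curve" for s
    using inward_normal[of "ang s"] by (simp add: point_def)
qed (use point_deriv smooth_point point_inj range_point in simp_all)

section \<open>The diameter of the candidates\<close>

lemma ends_in_curve: "(W, 0) \<in> curve" "(- W, 0) \<in> curve"
  using W_pos v_W by (auto simp: curve_eq)

lemma curve_norm:
  assumes "p \<in> curve"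
  shows "norm p \<le> W" and "norm p = W \<Longrightarrow> p = (W, 0) \<or> p = (- W, 0)"
proof -
  obtain \<phi> where p: "p = (xc \<phi>, yc \<phi>)" using assms by (auto simp: curve_def)
  obtain \<psi> where \<psi>: "0 \<le> \<psi>" "\<psi> \<le> pi / 2" "\<bar>xc \<phi>\<bar> = xc \<psi>" "\<bar>yc \<phi>\<bar> = yc \<psi>"
    using first_quadrant by blast
  have norm: "norm p = sqrt ((xc \<psi>)\<^sup>2 + (yc \<psi>)\<^sup>2)"
    unfolding p norm_Pair by (simp add: \<psi>(3,4)[symmetric])
  have less: "norm p < W" if "\<psi> \<noteq> pi / 2"
    unfolding norm using norm_less_W[of \<psi>] \<psi> that W_pos by (intro real_less_lsqrt) auto
  have eq: "p = (W, 0) \<or> p = (- W, 0)" if "\<psi> = pi / 2"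
  proof -
    have "\<bar>xc \<phi>\<bar> = W" "\<bar>yc \<phi>\<bar> = 0" using \<psi>(3,4) unfolding that W_def by simp_all
    then show ?thesis unfolding p by (auto simp: abs_if split: if_splits)
  qed
  show "norm p \<le> W"
  proof (cases "\<psi> = pi / 2")
    case True
    then show ?thesis using eq W_pos by (auto simp: norm_Pair)
  qed (use less in simp)
  show "p = (W, 0) \<or> p = (- W, 0)" if "norm p = W"
    using eq less that by (cases "\<psi> = pi / 2") simp_all
qed

text \<open>A chord is at most the sum of the norms of its ends, hence at most \<open>2 * W\<close>.
  Equality puts both ends at norm \<open>W\<close>, which only the two points on the x-axis
  have.\<close>

lemma max_diameter_curve:
  "max_diameter curve P P' \<longleftrightarrow> (P, P') = ((W, 0), (- W, 0)) \<or> (P, P') = ((- W, 0), (W, 0))"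
proof -
  have d: "dist (W, 0::real) (- W, 0::real) = 2 * W" "dist (- W, 0::real) (W, 0::real) = 2 * W"
    using W_pos by (simp_all add: dist_Pair_Pair dist_real_def real_sqrt_mult)
  have le: "dist p q \<le> norm p + norm q" for p q :: "real \<times> real"
    unfolding dist_norm by (rule norm_triangle_ineq4)
  have le2: "dist p q \<le> 2 * W" if "p \<in> curve" "q \<in> curve" for p q
    using le[of p q] curve_norm(1)[OF that(1)] curve_norm(1)[OF that(2)] by simp
  show ?thesis
  proof
    assume max: "max_diameter curve P P'"
    then have P: "P \<in> curve" "P' \<in> curve" by (auto simp: max_diameter_def)
    have "2 * W \<le> dist P P'"
      using max ends_in_curve d unfolding max_diameter_def by metis
    then have "norm P = W" "norm P' = W"
      using le[of P P'] curve_norm(1)[OF P(1)] curve_norm(1)[OF P(2)] by auto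
    moreover have "P \<noteq> P'" using \<open>2 * W \<le> dist P P'\<close> W_pos by auto
    ultimately show "(P, P') = ((W, 0), (- W, 0)) \<or> (P, P') = ((- W, 0), (W, 0))"
      using curve_norm(2)[OF P(1)] curve_norm(2)[OF P(2)] by auto
  next
    assume "(P, P') = ((W, 0), (- W, 0)) \<or> (P, P') = ((- W, 0), (W, 0))"
    then show "max_diameter curve P P'"
      using ends_in_curve d le2 by (auto simp: max_diameter_def)
  qed
qed

lemma curve_unique_max_diameter: "unique_max_diameter curve"
  unfolding unique_max_diameter_def max_diameter_curve
  by (rule ex1I[of _ "{(W, 0), (- W, 0)}"]) auto

lemma curve_in_adapted_frame: "in_adapted_frame curve"
  unfolding in_adapted_frame_def max_diameter_curve
  by (auto simp: midpoint_def zero_prod_def)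

lemma curve_time_invariant:
  assumes "c1 * enclosed_area curve = a" "c2 * enclosed_area curve = k * a"
  shows "time_invariant c1 c2 curve"
  unfolding time_invariant_def
proof (intro exI conjI allI)
  fix s
  have "deriv (\<lambda>s. - ang s) s = - ((1 - k * a * cos (ang s) * yc (ang s)) / a)"
    by (rule DERIV_imp_deriv[OF DERIV_minus[OF ang_deriv]])
  then show "- 1 + c1 * enclosed_area curve * (- deriv (\<lambda>s. - ang s) s)
      + c2 * enclosed_area curve * snd (point s) * cos (- ang s) = 0"
    unfolding assms using a_pos by (simp add: point_def)
qed (rule curve_param)

end

section \<open>The area as a function of the parameter\<close>

context dawson
begin

text \<open>The area integrand with one factor \<open>a\<close> removed, so that it is defined at
  \<open>a = 0\<close> too, the left end for the intermediate value argument.\<close>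

definition J :: "real \<Rightarrow> real" where
  "J a = integral {-(pi/2)..pi/2} (\<lambda>\<phi>. 2 * Y (a * cos \<phi>) / den (a * cos \<phi>) * cos \<phi>)"

lemma J_cont: "continuous_on {0..<M} J"
proof -
  have "continuous_on ({0..<M} \<times> cbox (-(pi/2)) (pi/2))
     (\<lambda>(a, \<phi>). 2 * Y (a * cos \<phi>) / den (a * cos \<phi>) * cos \<phi>)"
    unfolding split_beta
    by (intro continuous_intros ballI den_nz) (auto intro: abs_mult_cos_less)
  from integral_continuous_on_param[OF this] show ?thesis
    by (simp add: J_def[abs_def])
qed

lemma integrand_cont:
  assumes "0 \<le> a" "a < M"
  shows "continuous_on S (\<lambda>\<phi>. 2 * Y (a * cos \<phi>) / den (a * cos \<phi>) * cos \<phi>)"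
  by (intro continuous_intros ballI den_nz abs_mult_cos_less assms)

lemma integrand_less:
  assumes "0 \<le> u" "u < v" "v < M"
  shows "2 * Y u / den u < 2 * Y v / den v"
proof -
  have "0 \<le> Y u" using Y_pos[of u] assms by (cases "u = 0") auto
  then show ?thesis
    using den_pos[of v] den_pos[of u] den_less[of u v] Y_less[of u v] assms
    by (intro frac_less) auto
qed

text \<open>The integrand strictly grows with the parameter wherever \<open>cos \<phi> > 0\<close>:
  \<open>Y\<close> increases while \<open>den\<close> decreases.\<close>

lemma J_less:
  assumes "0 \<le> a" "a < b" "b < M"
  shows "J a < J b"
  unfolding J_def
proof (rule integral_less_real)
  fix \<phi> assume "\<phi> \<in> {-(pi/2)<..<pi/2}"
  then have c: "cos \<phi> > 0" by (intro cos_gt_zero_pi) auto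
  then have "a * cos \<phi> < b * cos \<phi>" "0 \<le> a * cos \<phi>" using assms by auto
  moreover have "b * cos \<phi> < M" using abs_mult_cos_less[of b \<phi>] assms by auto
  ultimately show "2 * Y (a * cos \<phi>) / den (a * cos \<phi>) * cos \<phi>
      < 2 * Y (b * cos \<phi>) / den (b * cos \<phi>) * cos \<phi>"
    using c by (intro mult_strict_right_mono integrand_less) auto
next
  have "-(pi/2) < pi/2" using pi_gt_zero by linarith
  then show "{-(pi/2)<..<pi/2} \<noteq> {}" by (simp only: greaterThanLessThan_empty_iff not_le)
qed (rule integrand_cont; use assms in simp)+

lemma J_0: "J 0 = 0"
  by (simp add: J_def)

end

section \<open>Area of the candidates and divergence of \<open>J\<close>\<close>

context candidate
begin

lemma area_curve_J: "enclosed_area curve = a * J a"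
proof -
  have "enclosed_area curve
      = integral {-(pi/2)..pi/2} (\<lambda>\<phi>. a * (2 * Y (a * cos \<phi>) / den (a * cos \<phi>) * cos \<phi>))"
    unfolding area_curve by (intro integral_cong) (simp add: yc_def rad_def)
  then show ?thesis by (simp only: J_def integral_mult_right)
qed

lemma D_yc: "D (yc \<phi>) = a * cos \<phi>"
  by (simp add: yc_def D_Y[OF a_cos_less])

lemma yc_less_ymax: "\<bar>yc \<phi>\<bar> < ymax"
  by (simp add: yc_def Y_bound[OF a_cos_less])

text \<open>As \<open>D (yc \<phi>) = a * cos \<phi>\<close> with \<open>a < M\<close>, the square
  of \<open>sin \<phi>\<close> is at most the left side of \<open>D_near_max\<close>.\<close>

lemma sin_le_gap:
  assumes "0 \<le> yc \<phi>"
  shows "\<bar>sin \<phi>\<bar> \<le> K * (ymax - yc \<phi>)"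
proof -
  have "(D (yc \<phi>) / M)\<^sup>2 \<le> (cos \<phi>)\<^sup>2"
  proof -
    have "\<bar>D (yc \<phi>) / M\<bar> = a / M * \<bar>cos \<phi>\<bar>"
      using a_pos M_pos by (simp add: D_yc abs_mult)
    also have "\<dots> \<le> 1 * \<bar>cos \<phi>\<bar>" using a_less M_pos by (intro mult_right_mono) auto
    finally show ?thesis by (simp only: mult_1 abs_le_square_iff)
  qed
  then have "(sin \<phi>)\<^sup>2 \<le> K\<^sup>2 * (ymax - yc \<phi>)\<^sup>2"
    using D_near_max[of "yc \<phi>"] assms yc_less_ymax[of \<phi>] sin_cos_squared_add[of \<phi>] by linarith
  then have "\<bar>sin \<phi>\<bar>\<^sup>2 \<le> (K * (ymax - yc \<phi>))\<^sup>2" by (simp add: power_mult_distrib)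
  then show ?thesis
    by (rule power2_le_imp_le) (use K_pos yc_less_ymax[of \<phi>] in auto)
qed

text \<open>The integrand of \<open>J\<close> dominates a multiple of the logarithmic derivative of
  \<open>ymax - yc\<close>, which makes \<open>J\<close> unbounded as \<open>a\<close> tends to \<open>M\<close>.\<close>

lemma J_lower_bound:
  "2 * yc 1 * cos 1 / (M * K) * (ln (ymax - yc 1) - ln (ymax - Y a)) \<le> J a"
proof -
  define f where "f \<phi> = 2 * Y (a * cos \<phi>) / den (a * cos \<phi>) * cos \<phi>" for \<phi>
  \<comment> \<open>The derivative of \<open>ln (ymax - yc \<phi>)\<close>.\<close>
  define g where "g \<phi> = rad \<phi> * sin \<phi> / (ymax - yc \<phi>)" for \<phi>
  \<comment> \<open>On \<open>{0..1}\<close> both \<open>yc\<close> and \<open>cos\<close> are at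
    least their values at 1, which are positive since \<open>1 < pi / 2\<close>; the denominator
    cancels the bound \<open>g x \<le> M * K / den (a * cos x)\<close>.\<close>
  let ?C = "2 * yc 1 * cos 1 / (M * K)"
  have 1: "1 < pi / 2" using pi_half_less_two pi_gt3 by simp
  have f_cont: "continuous_on S f" for S
    unfolding f_def using integrand_cont a_pos a_less by auto
  have f_eq: "f \<phi> = 2 * yc \<phi> / den (a * cos \<phi>) * cos \<phi>" for \<phi>
    by (simp add: f_def yc_def)
  have "(g has_integral ln (ymax - yc 1) - ln (ymax - yc 0)) {0..1}"
  proof (rule fundamental_theorem_of_calculus)
    fix x :: real assume "x \<in> {0..1}"
    have "((\<lambda>x. ln (ymax - yc x)) has_real_derivative g x) (at x)"
      using yc_less_ymax[of x] unfolding g_def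
      by (auto intro!: derivative_eq_intros simp: divide_simps)
    then show "((\<lambda>x. ln (ymax - yc x)) has_vector_derivative g x) (at x within {0..1})"
      by (simp add: has_real_derivative_iff_has_vector_derivative has_vector_derivative_at_within)
  qed simp
  then have "((\<lambda>x. ?C * g x) has_integral ?C * (ln (ymax - yc 1) - ln (ymax - yc 0))) {0..1}"
    by (rule has_integral_mult_right)
  moreover have "(f has_integral integral {0..1} f) {0..1}"
    by (intro integrable_integral integrable_continuous_interval f_cont)
  moreover have "?C * g x \<le> f x" if x: "x \<in> {0..1}" for x
  proof -
    have c: "cos 1 > (0::real)" "cos x \<ge> cos 1" "sin x \<ge> 0"
      using x 1 by (auto intro!: cos_gt_zero_pi cos_monotone_0_pi_le sin_ge_zero)
    have "a * cos 1 \<le> a * cos x" using c a_pos by simp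
    then have y: "yc 1 \<le> yc x"
      using Y_less[OF a_cos_less a_cos_less, of 1 x] unfolding yc_def
      by (cases "a * cos 1 = a * cos x") auto
    have y1: "yc 1 > 0" using c by (intro yc_pos)
    have w: "ymax - yc x > 0" using yc_less_ymax[of x] by simp
    have den: "den (a * cos x) > 0" using den_pos[OF a_cos_less] .
    have "sin x \<le> K * (ymax - yc x)" using sin_le_gap[of x] y y1 c by simp
    then have "sin x / (ymax - yc x) \<le> K" using w by (simp add: field_simps)
    then have "rad x * (sin x / (ymax - yc x)) \<le> (M / den (a * cos x)) * K"
      using rad_pos[of x] a_less a_pos den K_pos c w
      by (intro mult_mono) (auto simp: rad_def divide_right_mono)
    then have g: "g x \<le> M * K / den (a * cos x)" by (simp add: g_def)
    have "?C * g x \<le> ?C * (M * K / den (a * cos x))"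
      using g y1 c M_pos K_pos by (intro mult_left_mono) auto
    also have "\<dots> = 2 * yc 1 / den (a * cos x) * cos 1"
      using M_pos K_pos by simp
    also have "\<dots> \<le> f x"
      unfolding f_eq using y y1 c den by (intro mult_mono divide_right_mono) auto
    finally show ?thesis .
  qed
  ultimately have "?C * (ln (ymax - yc 1) - ln (ymax - yc 0)) \<le> integral {0..1} f"
    by (rule has_integral_le)
  also have "\<dots> \<le> integral {-(pi/2)..pi/2} f"
  proof (rule integral_subset_le)
    show "\<forall>x\<in>{-(pi/2)..pi/2}. 0 \<le> f x"
    proof
      fix x assume that: "x \<in> {-(pi/2)..pi/2}"
      have "cos x \<ge> 0" using that by (intro cos_ge_zero) auto
      moreover from this have "yc x \<ge> 0"
        using yc_pos[of x] by (cases "cos x = 0") (auto simp: yc_def)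
      ultimately show "0 \<le> f x" unfolding f_eq using den_pos[OF a_cos_less, of x] by simp
    qed
  qed (use 1 in \<open>auto intro!: integrable_continuous_interval f_cont\<close>)
  also have "\<dots> = J a" by (simp add: J_def f_def[abs_def])
  finally show ?thesis by (simp add: yc_def)
qed

end

context dawson
begin

text \<open>The parameter is chosen through its top height \<open>h = ymax - w\<close>. In
  \<open>J_lower_bound\<close> all but the last logarithm is controlled uniformly for parameters
  from \<open>M / 2\<close> up to \<open>M\<close>, so a small \<open>w\<close> suffices.\<close>

lemma J_unbounded: "\<exists>a. 0 < a \<and> a < M \<and> B \<le> J a"
proof -
  have c: "cos 1 > (0::real)" "cos 1 < (1::real)"
    using pi_gt3 cos_monotone_0_pi[of 0 1] by (auto intro!: cos_gt_zero_pi)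
  \<comment> \<open>\<open>\<delta>\<close> bounds \<open>ymax - yc 1\<close> and
    \<open>\<eta>\<close> bounds \<open>yc 1\<close> from below, uniformly in these
    parameters.\<close>
  define \<delta> where "\<delta> = ymax - Y (M * cos 1)"
  define \<eta> where "\<eta> = Y (M / 2 * cos 1)"
  define C where "C = 2 * \<eta> * cos 1 / (M * K)"
  \<comment> \<open>The first entry ensures \<open>M / 2 \<le> D h\<close>, the last a logarithmic
    difference of at least \<open>\<bar>B\<bar> / C\<close>.\<close>
  define w where "w = min (ymax - Y (M / 2)) (min \<delta> (exp (ln \<delta> - \<bar>B\<bar> / C)))"
  have Mc: "\<bar>M * cos 1\<bar> < M" "0 < M / 2 * cos 1" "M / 2 * cos 1 < M"
    using c M_pos by (auto simp: abs_mult intro: mult_strict_mono[of _ 1 _ 1])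
  have \<delta>: "\<delta> > 0" unfolding \<delta>_def using Y_bound[OF Mc(1)] by simp
  have \<eta>: "\<eta> > 0" unfolding \<eta>_def using Y_pos Mc by simp
  have C: "C > 0" unfolding C_def using \<eta> c M_pos K_pos by simp
  have YM2: "\<bar>Y (M / 2)\<bar> < ymax" "0 < Y (M / 2)"
    using Y_bound[of "M / 2"] Y_pos[of "M / 2"] M_pos by auto
  have w: "0 < w" "w \<le> ymax - Y (M / 2)" "w \<le> \<delta>" "ln w \<le> ln \<delta> - \<bar>B\<bar> / C"
  proof -
    show "0 < w" using YM2 \<delta> by (auto simp: w_def)
    then have "ln w \<le> ln (exp (ln \<delta> - \<bar>B\<bar> / C))" by (subst ln_le_cancel_iff) (auto simp: w_def)
    then show "ln w \<le> ln \<delta> - \<bar>B\<bar> / C" by simp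
  qed (auto simp: w_def)
  define h where "h = ymax - w"
  have h: "Y (M / 2) \<le> h" "h < ymax" using w by (auto simp: h_def)
  have a: "M / 2 \<le> D h" "D h < M"
    using D_less[of "Y (M / 2)" h] D_Y[of "M / 2"] D_less_M[of h] h YM2 M_pos
    by (cases "Y (M / 2) = h"; auto)+
  interpret candidate k "D h" by unfold_locales (use a M_pos in auto)
  have Yh: "Y (D h) = h" using h YM2 by (intro Y_D) auto
  have y1: "\<eta> \<le> yc 1" "yc 1 \<le> Y (M * cos 1)"
  proof -
    have "M / 2 * cos 1 \<le> D h * cos 1" "D h * cos 1 < M * cos 1" using a c by auto
    then show "yc 1 \<le> Y (M * cos 1)"
      unfolding yc_def using Y_less[OF a_cos_less Mc(1), of 1] by simp
    show "\<eta> \<le> yc 1"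
      using Y_less[of "M / 2 * cos 1" "D h * cos 1"] Mc a_cos_less[of 1]
        \<open>M / 2 * cos 1 \<le> D h * cos 1\<close>
      unfolding yc_def \<eta>_def by (cases "M / 2 * cos 1 = D h * cos 1") auto
  qed
  have ln: "\<bar>B\<bar> / C \<le> ln (ymax - yc 1) - ln (ymax - Y (D h))"
  proof -
    have "\<delta> \<le> ymax - yc 1" using y1 by (simp add: \<delta>_def)
    then have "ln \<delta> \<le> ln (ymax - yc 1)" using \<delta> by simp
    moreover have "ymax - Y (D h) = w" unfolding Yh by (simp add: h_def)
    ultimately show ?thesis using w(4) by simp
  qed
  have "C \<le> 2 * yc 1 * cos 1 / (M * K)"
    unfolding C_def using y1 c M_pos K_pos by (intro divide_right_mono mult_right_mono) auto
  then have "C * (\<bar>B\<bar> / C) \<le> 2 * yc 1 * cos 1 / (M * K) * (ln (ymax - yc 1) - ln (ymax - Y (D h)))"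
    using ln C by (intro mult_mono) auto
  also have "\<dots> \<le> J (D h)" by (rule J_lower_bound)
  finally have "B \<le> J (D h)" using C by simp
  then show ?thesis using a_pos a_less by blast
qed

lemma J_unique_solution:
  assumes "B > 0"
  shows "\<exists>!a. 0 < a \<and> a < M \<and> J a = B"
proof -
  obtain b where b: "0 < b" "b < M" "B \<le> J b" using J_unbounded by blast
  have "continuous_on {0..b} J" by (rule continuous_on_subset[OF J_cont]) (use b in auto)
  then obtain a where a: "0 \<le> a" "a \<le> b" "J a = B"
    using IVT'[of J 0 B b] b assms by (auto simp: J_0)
  then have "a \<noteq> 0" using J_0 assms by auto
  moreover have "a' = a" if "0 < a'" "a' < M" "J a' = B" for a'
    using J_less[of a a'] J_less[of a' a] a b that by (cases a a' rule: linorder_cases) auto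
  ultimately show ?thesis using a b by (intro ex1I[of _ a]) auto
qed

end

section \<open>Uniqueness\<close>

lemma periodic_representative:
  fixes p :: "real \<Rightarrow> 'a"
  assumes p: "\<And>s. p (s + L) = p s" and L: "L > 0"
  obtains t where "b \<le> t" "t \<le> b + L" "p t = p s"
proof
  have period: "p (z + of_int n * L) = p z" for z and n :: int
  proof (induction n rule: int_induct[where k = 0])
    case (step1 i)
    then show ?case using p[of "z + of_int i * L"] by (simp add: algebra_simps)
  next
    case (step2 i)
    then show ?case using p[of "z + of_int (i - 1) * L"] by (simp add: algebra_simps)
  qed simp
  define n where "n = \<lfloor>(s - b) / L\<rfloor>"
  have "of_int n \<le> (s - b) / L" "(s - b) / L \<le> of_int n + 1" unfolding n_def by linarith+
  then have "of_int n * L \<le> s - b" "s - b \<le> (of_int n + 1) * L"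
    using L by (simp_all add: field_simps)
  then show "b \<le> s - of_int n * L" "s - of_int n * L \<le> b + L"
    by (simp_all add: algebra_simps)
  show "p (s - of_int n * L) = p s" using period[of "s - of_int n * L" n] by simp
qed

context dawson
begin

text \<open>The arc length derivative of \<open>cos \<gamma> exp (k y\<^sup>2 / 2) - F y / a\<close> vanishes, and the
  diameter meets the curve at height zero with \<open>cos \<gamma> = 0\<close>.\<close>

lemma first_integral:
  assumes param: "clockwise_arclength_param G L p g"
    and diam: "unique_max_diameter G" "in_adapted_frame G"
    and a: "a > 0"
    and g': "\<And>s. (g has_real_derivative - ((1 - k * a * snd (p s) * cos (g s)) / a)) (at s)"
  shows "D (snd (p s)) = a * cos (g s)" and "\<exists>s. snd (p s) = 0"
proof -
  note param = param[unfolded clockwise_arclength_param_def]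
  have x': "((\<lambda>s. fst (p s)) has_real_derivative cos (g s)) (at s)"
    and y': "((\<lambda>s. snd (p s)) has_real_derivative sin (g s)) (at s)" for s
    using param by auto
  obtain P P' where max: "max_diameter G P P'"
    using diam(1) unfolding unique_max_diameter_def by blast
  then have P: "P \<in> G" "P' \<in> G" and dist: "\<And>X Y. X \<in> G \<Longrightarrow> Y \<in> G \<Longrightarrow> dist X Y \<le> dist P P'"
    by (auto simp: max_diameter_def)
  have snd: "snd P = 0" "snd P' = 0" using diam(2) max unfolding in_adapted_frame_def by blast+
  obtain s0 where s0: "P = p s0" using P param by auto
  have "P \<noteq> P'"
  proof
    assume "P = P'"
    have "p 0 \<in> G" "p (L / 2) \<in> G" using param by auto
    then have "p 0 = p (L / 2)" using dist[of "p 0" "p (L / 2)"] \<open>P = P'\<close> by simp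
    moreover have "0 \<in> {0..<L}" "L / 2 \<in> {0..<L}" "inj_on p {0..<L}" using param by auto
    ultimately have "0 = L / 2" by (meson inj_onD)
    then show False using param by auto
  qed
  then have fst: "fst (p s0) \<noteq> fst P'" using snd s0 by (simp add: prod_eq_iff)
  \<comment> \<open>The squared distance to \<open>P'\<close> is maximal at \<open>P\<close>, so its
    derivative vanishes: the tangent is perpendicular to the diameter.\<close>
  have "2 * (fst (p s0) - fst P') * cos (g s0) = 0"
  proof (rule DERIV_local_max[of _ _ _ 1])
    show "((\<lambda>s. (fst (p s) - fst P')\<^sup>2 + (snd (p s))\<^sup>2) has_real_derivative
           2 * (fst (p s0) - fst P') * cos (g s0)) (at s0)"
      using snd s0 by (auto intro!: derivative_eq_intros x' y')
    have "p s \<in> G" for s using param by blast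
    then have "dist (p s) P' \<le> dist P P'" for s using dist P by blast
    moreover have "dist q P' = sqrt ((fst q - fst P')\<^sup>2 + (snd q)\<^sup>2)" for q
      using snd by (simp add: dist_prod_def dist_real_def)
    ultimately have "(fst (p s) - fst P')\<^sup>2 + (snd (p s))\<^sup>2
        \<le> (fst (p s0) - fst P')\<^sup>2 + (snd (p s0))\<^sup>2" for s
      unfolding s0 by (simp only: real_sqrt_le_iff)
    then show "\<forall>s. \<bar>s0 - s\<bar> < 1 \<longrightarrow> (fst (p s) - fst P')\<^sup>2 + (snd (p s))\<^sup>2
        \<le> (fst (p s0) - fst P')\<^sup>2 + (snd (p s0))\<^sup>2" by simp
  qed simp
  then have cos: "cos (g s0) = 0" using fst by simp
  have "((\<lambda>s. a * cos (g s) * exp (k * (snd (p s))\<^sup>2 / 2) - F (snd (p s))) has_real_derivative 0) (at s)"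
    for s
  proof -
    let ?y = "snd (p s)" and ?e = "exp (k * (snd (p s))\<^sup>2 / 2)"
    have "((\<lambda>s. a * cos (g s) * exp (k * (snd (p s))\<^sup>2 / 2) - F (snd (p s))) has_real_derivative
        a * (- sin (g s) * - ((1 - k * a * ?y * cos (g s)) / a)) * ?e
         + ?e * (k * ?y * sin (g s)) * (a * cos (g s)) - ?e * sin (g s)) (at s)"
      by (auto intro!: derivative_eq_intros g' y' DERIV_chain2[OF F_deriv])
    also have "a * (- sin (g s) * - ((1 - k * a * ?y * cos (g s)) / a)) = sin (g s) * (1 - k * a * ?y * cos (g s))"
      using a by simp
    finally show ?thesis by (simp add: algebra_simps)
  qed
  then have "a * cos (g s) * exp (k * (snd (p s))\<^sup>2 / 2) - F (snd (p s))
      = a * cos (g s0) * exp (k * (snd (p s0))\<^sup>2 / 2) - F (snd (p s0))"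
    by (rule DERIV_isconst_all[OF allI])
  also have "\<dots> = 0" using cos snd s0 by (simp add: F_0)
  finally show "D (snd (p s)) = a * cos (g s)"
    by (simp add: F_eq)
  show "\<exists>s. snd (p s) = 0" using snd s0 by blast
qed

text \<open>For \<open>a = M\<close> a curve touching the line at height \<open>ymax\<close> would be contained in it
  (Gronwall's inequality for the gap \<open>ymax - y\<close>); for \<open>a > M\<close> the tangent is never horizontal.\<close>

lemma parameter_less_M:
  assumes param: "clockwise_arclength_param G L p g"
    and a: "a > 0"
    and D: "\<And>s. D (snd (p s)) = a * cos (g s)"
    and zero: "\<exists>s. snd (p s) = 0"
  shows "a < M"
proof (rule ccontr)
  assume "\<not> a < M"
  note param = param[unfolded clockwise_arclength_param_def]
  have L: "L > 0" and period: "\<And>s. p (s + L) = p s" using param by auto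
  have y': "((\<lambda>s. snd (p s)) has_real_derivative sin (g s)) (at s)" for s
    using param by auto
  have "continuous_on {0..L} (\<lambda>s. snd (p s))"
    by (rule continuous_at_imp_continuous_on) (auto intro: DERIV_isCont[OF y'])
  then obtain s1 where s1: "s1 \<in> {0..L}" "\<And>s. s \<in> {0..L} \<Longrightarrow> snd (p s) \<le> snd (p s1)"
    using continuous_attains_sup[of "{0..L}" "\<lambda>s. snd (p s)"] L by fastforce
  have top: "snd (p s) \<le> snd (p s1)" for s
  proof -
    obtain t where t: "0 \<le> t" "t \<le> 0 + L" "p t = p s"
      by (rule periodic_representative[where p = p, OF period L])
    then show ?thesis using s1(2)[of t] by auto
  qed
  \<comment> \<open>The tangent is horizontal at the top, so \<open>D\<close> takes the value
    \<open>a\<close> there. Since \<open>D\<close> is at most \<open>M\<close> on nonnegative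
    heights, \<open>a = M\<close> and the top has height \<open>ymax\<close>.\<close>
  have "sin (g s1) = 0"
    by (rule DERIV_local_max[OF y', of 1]) (use top in auto)
  then have "\<bar>cos (g s1)\<bar> = 1"
    using sin_cos_squared_add[of "g s1"] by (simp add: abs_square_eq_1)
  moreover have y1: "snd (p s1) \<ge> 0" using zero top by metis
  then have "D (snd (p s1)) \<ge> 0" using D_pos[of "snd (p s1)"] by (cases "snd (p s1) = 0") auto
  then have "cos (g s1) \<ge> 0" using D[of s1] a by (simp add: zero_le_mult_iff)
  ultimately have D1: "D (snd (p s1)) = a" using D[of s1] by simp
  then have ym: "snd (p s1) = ymax" and aM: "a = M"
    using D_less_M[OF y1] D_le_M[OF y1] \<open>\<not> a < M\<close> by auto
  define w where "w s = ymax - snd (p s)" for s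
  have w_nonneg: "w s \<ge> 0" for s using top ym by (simp add: w_def)
  have sin: "\<bar>sin (g s)\<bar> \<le> K * w s" for s
  proof (cases "snd (p s) \<ge> 0")
    case True
    have "1 - (cos (g s))\<^sup>2 \<le> K\<^sup>2 * (w s)\<^sup>2"
      using D_near_max[OF True] top[of s] ym D[of s] M_pos by (simp add: aM w_def)
    then have "\<bar>sin (g s)\<bar>\<^sup>2 \<le> (K * w s)\<^sup>2"
      by (simp add: power_mult_distrib sin_squared_eq)
    then show ?thesis by (rule power2_le_imp_le) (use K_pos w_nonneg[of s] in simp)
  next
    case False
    \<comment> \<open>Below the axis the trivial bound on \<open>sin\<close> suffices, since
      \<open>D_near_max\<close> at height 0 gives \<open>1 \<le> K * ymax\<close>.\<close>
    have "1\<^sup>2 \<le> (K * ymax)\<^sup>2" using D_near_max[of 0] ymax_pos by (simp add: power_mult_distrib)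
    then have "1 \<le> K * ymax" by (rule power2_le_imp_le) (use K_pos ymax_pos in simp)
    also have "\<dots> \<le> K * w s" using K_pos False by (simp add: w_def)
    finally show ?thesis using abs_sin_le_one[of "g s"] by linarith
  qed
  obtain s2 where "snd (p s2) = 0" using zero by blast
  moreover obtain t where t: "s1 \<le> t" "t \<le> s1 + L" "p t = p s2"
    by (rule periodic_representative[where p = p, OF period L])
  ultimately have t0: "snd (p t) = 0" by simp
  \<comment> \<open>Gronwall: the gap is zero at \<open>s1\<close>, hence stays zero up to
    \<open>t\<close>, although the height at \<open>t\<close> is zero.\<close>
  have "w t * exp (- K * t) \<le> w s1 * exp (- K * s1)"
  proof (rule DERIV_nonpos_imp_nonincreasing[OF t(1)])
    fix s
    have "((\<lambda>s. w s * exp (- K * s)) has_real_derivative exp (- K * s) * (- sin (g s) - K * w s)) (at s)"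
      unfolding w_def by (auto intro!: derivative_eq_intros y' simp: algebra_simps)
    moreover have "exp (- K * s) * (- sin (g s) - K * w s) \<le> 0"
      using sin[of s] by (intro mult_nonneg_nonpos) auto
    ultimately show "\<exists>d. ((\<lambda>s. w s * exp (- K * s)) has_real_derivative d) (at s) \<and> d \<le> 0"
      by blast
  qed
  then have "w t \<le> 0" using ym by (simp add: w_def mult_le_0_iff)
  then show False using t0 ymax_pos by (simp add: w_def)
qed

text \<open>Otherwise, by continuity from height zero, the modulus of the height equals
  \<open>ymax\<close> somewhere, and there \<open>\<bar>D\<bar>\<close> is \<open>M\<close>,
  exceeding \<open>a\<close>. Within the bound, \<open>Y\<close> recovers the height from
  \<open>D\<close>.\<close>

lemma height_bound:
  assumes param: "clockwise_arclength_param G L p g"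
    and a: "a > 0" "a < M"
    and D: "\<And>s. D (snd (p s)) = a * cos (g s)"
    and zero: "\<exists>s. snd (p s) = 0"
  shows "\<bar>snd (p s)\<bar> < ymax"
proof (rule ccontr)
  assume high: "\<not> \<bar>snd (p s)\<bar> < ymax"
  have cont: "isCont (\<lambda>s. \<bar>snd (p s)\<bar>) s" for s
  proof -
    have "isCont (\<lambda>s. snd (p s)) s"
      using param unfolding clockwise_arclength_param_def by (blast intro: DERIV_isCont)
    then show ?thesis by (rule isCont_rabs)
  qed
  obtain s0 where "snd (p s0) = 0" using zero by blast
  then have "\<bar>snd (p s0)\<bar> \<le> ymax" "ymax \<le> \<bar>snd (p s)\<bar>" using ymax_pos high by auto
  then obtain z where "\<bar>snd (p z)\<bar> = ymax"
    using IVT[of "\<lambda>s. \<bar>snd (p s)\<bar>" s0 ymax s] IVT2[of "\<lambda>s. \<bar>snd (p s)\<bar>" s0 ymax s] cont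
    by (cases "s0 \<le> s") auto
  then have "snd (p z) = ymax \<or> snd (p z) = - ymax" by linarith
  then have "\<bar>D (snd (p z))\<bar> = M"
    using M_pos unfolding M_def by auto
  moreover have "\<bar>D (snd (p z))\<bar> \<le> a * 1"
    unfolding D abs_mult using a by (intro mult_mono) auto
  ultimately show False using a by simp
qed

text \<open>Inverting \<open>D\<close> gives the height as \<open>yc (- g s)\<close>. Then
  \<open>- g\<close> turns at the rate of the candidate, and the first coordinate matches
  \<open>xc\<close> up to a constant \<open>c\<close>, which the adapted frame makes zero.\<close>

lemma eq_curve:
  assumes param: "clockwise_arclength_param G L p g"
    and diam: "unique_max_diameter G" "in_adapted_frame G"
    and a: "a > 0"
    and g': "\<And>s. (g has_real_derivative - ((1 - k * a * snd (p s) * cos (g s)) / a)) (at s)"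
  shows "candidate k a" and "G = candidate.curve k a"
proof -
  note fi = first_integral[OF param diam a g']
  have aM: "a < M" by (rule parameter_less_M[OF param a fi])
  show "candidate k a" by unfold_locales (use a aM in auto)
  then interpret candidate k a .
  note param' = param[unfolded clockwise_arclength_param_def]
  have x': "((\<lambda>s. fst (p s)) has_real_derivative cos (g s)) (at s)" for s
    using param' by auto
  have y: "snd (p s) = yc (- g s)" for s
    using Y_D[of "snd (p s)"] height_bound[OF param a aM fi, of s] fi(1)[of s]
    by (simp add: yc_def)
  have ang': "((\<lambda>s. - g s) has_real_derivative 1 / rad (- g s)) (at s)" for s
  proof -
    have "(1 - k * a * snd (p s) * cos (g s)) / a = 1 / rad (- g s)"
      unfolding y rad_def den_def yc_def by (simp add: mult_ac)
    then show ?thesis using DERIV_minus[OF g'[of s]] by simp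
  qed
  have "((\<lambda>s. fst (p s) - xc (- g s)) has_real_derivative 0) (at s)" for s
    using DERIV_diff[OF x' DERIV_chain2[OF xc_deriv ang'], of s] rad_pos[of "- g s"] by simp
  then have "fst (p s) - xc (- g s) = fst (p 0) - xc (- g 0)" for s
    by (rule DERIV_isconst_all[OF allI])
  then obtain c where x: "fst (p s) = xc (- g s) + c" for s
    by (metis add.commute diff_add_cancel)
  \<comment> \<open>Shows that \<open>- g\<close> takes every value, so that \<open>G\<close> is the
    whole translated candidate.\<close>
  have "((\<lambda>s. arclen (- g s) - s) has_real_derivative 0) (at s)" for s
    using DERIV_diff[OF DERIV_chain2[OF arclen_deriv ang'] DERIV_ident, of s] rad_pos[of "- g s"]
    by simp
  then have "arclen (- g s) - s = arclen (- g 0) - 0" for s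
    by (rule DERIV_isconst_all[OF allI])
  then have "arclen (- g (arclen \<phi> - arclen (- g 0))) = arclen \<phi>" for \<phi>
    by (metis add_diff_cancel_left' diff_add_cancel diff_zero)
  then have surj: "- g (arclen \<phi> - arclen (- g 0)) = \<phi>" for \<phi>
    using ang_arclen by metis
  have "p s = (xc (- g s), yc (- g s)) + (c, 0)" for s
    by (simp add: prod_eq_iff x y)
  then have p: "p = (\<lambda>q. q + (c, 0)) \<circ> (\<lambda>\<phi>. (xc \<phi>, yc \<phi>)) \<circ> (\<lambda>s. - g s)"
    by auto
  have "range (\<lambda>s. - g s) = UNIV" using surj by (rule surjI)
  then have G: "G = (\<lambda>q. q + (c, 0)) ` curve"
    using param' unfolding p curve_def by (metis image_comp)
  have "max_diameter curve (W, 0) (- W, 0)" by (simp add: max_diameter_curve)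
  then have "max_diameter G ((W, 0) + (c, 0)) ((- W, 0) + (c, 0))"
    unfolding max_diameter_def G by (auto simp del: add_Pair)
  then have "midpoint ((W, 0) + (c, 0)) ((- W, 0) + (c, 0)) = (0 :: real \<times> real)"
    using diam(2) unfolding in_adapted_frame_def by blast
  then have "c = 0" by (simp add: midpoint_def zero_prod_def)
  then show "G = curve" unfolding G by (simp add: zero_prod_def[symmetric])
qed

end

theorem theorem2:
  fixes c1 c2 :: real
  assumes "c1 > 0" and "c2 > 0"
  shows "\<exists>!G. smooth_simple_closed_curve G \<and> convex_curve G \<and>
              unique_max_diameter G \<and> in_adapted_frame G \<and> time_invariant c1 c2 G"
proof -
  define k where "k = c2 / c1"
  have c2_eq: "c2 = k * c1" using assms by (simp add: k_def)
  interpret dawson k by unfold_locales (use assms in \<open>simp add: k_def\<close>)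
  obtain a where a: "0 < a" "a < M" "J a = 1 / c1"
    and unique: "\<And>b. 0 < b \<Longrightarrow> b < M \<Longrightarrow> J b = 1 / c1 \<Longrightarrow> b = a"
  proof -
    have "\<exists>!a. 0 < a \<and> a < M \<and> J a = 1 / c1"
      by (rule J_unique_solution) (use assms in simp)
    then show ?thesis using that by blast
  qed
  interpret candidate k a by unfold_locales (use a in auto)
  show ?thesis
  proof (rule ex1I[of _ curve])
    have "enclosed_area curve = a / c1" using a(3) by (simp add: area_curve_J)
    then have "time_invariant c1 c2 curve"
      using assms c2_eq by (intro curve_time_invariant) simp_all
    then show "smooth_simple_closed_curve curve \<and> convex_curve curve \<and>
        unique_max_diameter curve \<and> in_adapted_frame curve \<and> time_invariant c1 c2 curve"
      using curve_param curve_convex curve_unique_max_diameter curve_in_adapted_frame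
      unfolding smooth_simple_closed_curve_def by blast
  next
    fix G
    assume G: "smooth_simple_closed_curve G \<and> convex_curve G \<and>
        unique_max_diameter G \<and> in_adapted_frame G \<and> time_invariant c1 c2 G"
    then obtain L p g where param: "clockwise_arclength_param G L p g"
      and eq: "\<And>s. - 1 + c1 * enclosed_area G * (- deriv g s)
               + c2 * enclosed_area G * snd (p s) * cos (g s) = 0"
      unfolding time_invariant_def by blast
    define b where "b = c1 * enclosed_area G"
    \<comment> \<open>With zero area the stationary equation would read
      \<open>- 1 = 0\<close>.\<close>
    have "enclosed_area G \<noteq> 0" using eq[of 0] by auto
    then have "enclosed_area G > 0"
      using measure_nonneg[of lebesgue "inside G"] unfolding enclosed_area_def by linarith
    then have b: "b > 0" using assms by (simp add: b_def)
    have c2: "c2 * enclosed_area G = k * b" using c2_eq by (simp add: b_def)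
    have g': "(g has_real_derivative - ((1 - k * b * snd (p s) * cos (g s)) / b)) (at s)" for s
    proof -
      have "deriv g s = - ((1 - k * b * snd (p s) * cos (g s)) / b)"
        using eq[of s] b unfolding c2 b_def[symmetric] by (simp add: field_simps)
      moreover have "smooth_fun g" using param by (simp add: clockwise_arclength_param_def)
      then have "(deriv ^^ 0) g differentiable_on UNIV" unfolding smooth_fun_def by blast
      then have "g field_differentiable at s"
        by (auto simp: differentiable_on_def real_differentiable_def field_differentiable_def)
      ultimately show ?thesis by (metis DERIV_deriv_iff_field_differentiable)
    qed
    have "candidate k b" and Gb: "G = candidate.curve k b"
      using eq_curve[OF param _ _ b g'] G by auto
    then interpret b: candidate k b by blast
    \<comment> \<open>The parameter read off from \<open>G\<close> must reproduce the area of the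
      candidate that \<open>G\<close> turned out to be.\<close>
    have "b = c1 * (b * J b)"
      using b.area_curve_J unfolding Gb[symmetric] by (simp add: b_def)
    then have "J b = 1 / c1" using b assms by (simp add: field_simps)
    then have "b = a" using unique b.a_pos b.a_less by blast
    then show "G = curve" using Gb by simp
  qed
qed

end
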